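(* Let $H$ be a quasi-bialgebra, $\mathfrak A$ a right $H$-comodule algebra, $\mathfrak B$ a left $H$-comodule algebra and $\mathcal A$ an $H$-bimodule algebra. Consider the left $H$-module algebra $\mathfrak A\,\overline{\#}\,\mathcal A$ and the right $H$-module algebra $\mathcal A\,\overline{\#}\,\mathfrak B$. Then the trivial identifications give algebra isomorphisms $$\mathfrak A>\!\!\triangleleft\,\mathcal A\,\triangleright\!\!<\mathfrak B\equiv(\mathfrak A\,\overline{\#}\,\mathcal A)\blacktriangleright\!\!<\mathfrak B,\qquad\mathfrak A>\!\!\triangleleft\,\mathcal A\,\triangleright\!\!<\mathfrak B\equiv\mathfrak A>\!\!\blacktriangleleft(\mathcal A\,\overline{\#}\,\mathfrak B).$$
   Context: All algebras and spaces are over a field $k$, $\otimes=\otimes_k$; summation is understood. A quasi-bialgebra $(H,\Delta,\varepsilon,\Phi)$: a unital associative algebra $H$, algebra maps $\Delta:H\to H\otimes H$ ($\Delta(h)=h_1\otimes h_2$), $\varepsilon:H\to k$, and an invertible $\Phi=X^1\otimes X^2\otimes X^3\in H^{\otimes3}$, $\Phi^{-1}=x^1\otimes x^2\otimes x^3$, with $(id\otimes\Delta)(\Delta(h))=\Phi(\Delta\otimes id)(\Delta(h))\Phi^{-1}$, $(id\otimes\varepsilon)\Delta=id=(\varepsilon\otimes id)\Delta$, $(1\otimes\Phi)(id\otimes\Delta\otimes id)(\Phi)(\Phi\otimes1)=(id\otimes id\otimes\Delta)(\Phi)(\Delta\otimes id\otimes id)(\Phi)$, $(id\otimes\varepsilon\otimes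 id)(\Phi)=1\otimes1$. A left $H$-module algebra: a left $H$-module $A$ with bilinear multiplication and two-sided unit $1_A$ with $(aa')a''=(X^1\cdot a)[(X^2\cdot a')(X^3\cdot a'')]$, $h\cdot(aa')=(h_1\cdot a)(h_2\cdot a')$, $h\cdot1_A=\varepsilon(h)1_A$. A right $H$-module algebra: a right $H$-module $B$ with bilinear multiplication and two-sided unit $1_B$ with $(bb')b''=(b\cdot x^1)[(b'\cdot x^2)(b''\cdot x^3)]$, $(bb')\cdot h=(b\cdot h_1)(b'\cdot h_2)$, $1_B\cdot h=\varepsilon(h)1_B$. An $H$-bimodule algebra: an $H$-bimodule $\mathcal A$ with a bilinear multiplication and a two-sided unit $1_{\mathcal A}$ such that $(\varphi\varphi')\varphi''=(X^1\cdot\varphi\cdot x^1)[(X^2\cdot\varphi'\cdot x^2)(X^3\cdot\varphi''\cdot x^3)]$, $h\cdot(\varphi\varphi')=(h_1\cdot\varphi)(h_2\cdot\varphi')$, $(\varphi\varphi')\cdot h=(\varphi\cdot h_1)(\varphi'\cdot h_2)$, $h\cdot1_{\mathcal A}=\varepsilon(h)1_{\mathcal A}=1_{\mathcal A}\cdot h$. A right $H$-comodule algebra: a unital associative algebra $\mathfrak A$, an algebra map $\rho:\mathfrak A\to\mathfrak A\otimes H$, $\rho(a)=a_{\langle0\rangle}\otimes a_{\langle1\rangle}$, and an invertible $\Phi_\rho\in\mathfrak A\otimes H\otimes H$, $\Phi_\rho^{-1}=\tilde x^1_\rho\otimes\tilde x^2_\rho\otimes\tilde x^3_\rho$, with $\Phi_\rho(\rho\otimes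 id)(\rho(a))=(id\otimes\Delta)(\rho(a))\Phi_\rho$, $(1\otimes\Phi)(id\otimes\Delta\otimes id)(\Phi_\rho)(\Phi_\rho\otimes1)=(id\otimes id\otimes\Delta)(\Phi_\rho)(\rho\otimes id\otimes id)(\Phi_\rho)$, $(id\otimes\varepsilon)\rho=id$, $(id\otimes\varepsilon\otimes id)(\Phi_\rho)=(id\otimes id\otimes\varepsilon)(\Phi_\rho)=1\otimes1$. A left $H$-comodule algebra: a unital associative algebra $\mathfrak B$, an algebra map $\lambda:\mathfrak B\to H\otimes\mathfrak B$, $\lambda(b)=b_{[-1]}\otimes b_{[0]}$, and an invertible $\Phi_\lambda\in H\otimes H\otimes\mathfrak B$, $\Phi_\lambda^{-1}=\tilde x^1_\lambda\otimes\tilde x^2_\lambda\otimes\tilde x^3_\lambda$, with $(id\otimes\lambda)(\lambda(b))\Phi_\lambda=\Phi_\lambda(\Delta\otimes id)(\lambda(b))$, $(1\otimes\Phi_\lambda)(id\otimes\Delta\otimes id)(\Phi_\lambda)(\Phi\otimes1)=(id\otimes id\otimes\lambda)(\Phi_\lambda)(\Delta\otimes id\otimes id)(\Phi_\lambda)$, $(\varepsilon\otimes id)\lambda=id$, $(id\otimes\varepsilon\otimes id)(\Phi_\lambda)=(\varepsilon\otimes id\otimes id)(\Phi_\lambda)=1\otimes1$. Quasi-smash products: $\mathfrak A\,\overline{\#}\,\mathcal A$ is $\mathfrak A\otimes\mathcal A$ with multiplication $(a\overline{\#}\varphi)(a'\overline{\#}\varphi')=aa'_{\langle0\rangle}\tilde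 x^1_\rho\overline{\#}(\varphi\cdot a'_{\langle1\rangle}\tilde x^2_\rho)(\varphi'\cdot\tilde x^3_\rho)$, unit $1_{\mathfrak A}\overline{\#}1_{\mathcal A}$ and left $H$-action $h\cdot(a\overline{\#}\varphi)=a\overline{\#}h\cdot\varphi$; it is a left $H$-module algebra. $\mathcal A\,\overline{\#}\,\mathfrak B$ is $\mathcal A\otimes\mathfrak B$ with multiplication $(\varphi\overline{\#}b)(\varphi'\overline{\#}b')=(\tilde x^1_\lambda\cdot\varphi)(\tilde x^2_\lambda b_{[-1]}\cdot\varphi')\overline{\#}\tilde x^3_\lambda b_{[0]}b'$, unit $1_{\mathcal A}\overline{\#}1_{\mathfrak B}$ and right $H$-action $(\varphi\overline{\#}b)\cdot h=\varphi\cdot h\overline{\#}b$; it is a right $H$-module algebra. Algebras (all associative and unital): $A\blacktriangleright\!\!<\mathfrak B$ ($A$ a left $H$-module algebra): $A\otimes\mathfrak B$ with $(a\blacktriangleright\!\!<b)(a'\blacktriangleright\!\!<b')=(\tilde x^1_\lambda\cdot a)(\tilde x^2_\lambda b_{[-1]}\cdot a')\blacktriangleright\!\!<\tilde x^3_\lambda b_{[0]}b'$; $\mathfrak A>\!\!\blacktriangleleft B$ ($B$ a right $H$-module algebra): $\mathfrak A\otimes B$ with $(a>\!\!\blacktriangleleft b)(a'>\!\!\blacktriangleleft b')=aa'_{\langle0\rangle}\tilde x^1_\rho>\!\!\blacktriangleleft(b\cdot a'_{\langle1\rangle}\tilde x^2_\rho)(b'\cdot\tilde x^3_\rho)$; generalized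 two-sided crossed product $\mathfrak A>\!\!\triangleleft\,\mathcal A\,\triangleright\!\!<\mathfrak B$: $\mathfrak A\otimes\mathcal A\otimes\mathfrak B$ with $(a>\!\!\triangleleft\varphi\triangleright\!\!<b)(a'>\!\!\triangleleft\varphi'\triangleright\!\!<b')=aa'_{\langle0\rangle}\tilde x^1_\rho>\!\!\triangleleft(\tilde x^1_\lambda\cdot\varphi\cdot a'_{\langle1\rangle}\tilde x^2_\rho)(\tilde x^2_\lambda b_{[-1]}\cdot\varphi'\cdot\tilde x^3_\rho)\triangleright\!\!<\tilde x^3_\lambda b_{[0]}b'$. *)

theory Defs
  imports "HOL-Algebra.Module"
begin

section \<open>Linear and bilinear maps\<close>

definition linear_map ::
  "'k ring \<Rightarrow> ('k, 'v) module \<Rightarrow> ('k, 'w) module \<Rightarrow> ('v \<Rightarrow> 'w) \<Rightarrow> bool" where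
  "linear_map K V W f \<longleftrightarrow>
    f \<in> carrier V \<rightarrow> carrier W \<and>
    (\<forall>v\<in>carrier V. \<forall>v'\<in>carrier V. f (v \<oplus>\<^bsub>V\<^esub> v') = f v \<oplus>\<^bsub>W\<^esub> f v') \<and>
    (\<forall>c\<in>carrier K. \<forall>v\<in>carrier V. f (c \<odot>\<^bsub>V\<^esub> v) = c \<odot>\<^bsub>W\<^esub> f v)"

definition bilinear_map ::
  "'k ring \<Rightarrow> ('k, 'v) module \<Rightarrow> ('k, 'w) module \<Rightarrow> ('k, 'u) module \<Rightarrow> ('v \<Rightarrow> 'w \<Rightarrow> 'u) \<Rightarrow> bool" where
  "bilinear_map K V W U f \<longleftrightarrow>
    (\<forall>v\<in>carrier V. linear_map K W U (f v)) \<and>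
    (\<forall>w\<in>carrier W. linear_map K V U (\<lambda>v. f v w))"


section \<open>Tensor products of modules\<close>

text \<open>
  HOL-Algebra has no tensor product.  We use the presentation of \<open>V \<otimes> W\<close> by generators
  \<open>v \<otimes> w\<close> and relations.  A list \<open>[(v\<^sub>1, w\<^sub>1), \<dots>, (v\<^sub>n, w\<^sub>n)]\<close> is read as the formal sum of
  the \<open>v\<^sub>i \<otimes> w\<^sub>i\<close>; two formal sums are identified by the smallest congruence that makes the sum
  commutative, \<open>\<otimes>\<close> additive in both arguments and \<open>K\<close>-balanced.  Elements of the tensor product
  are the equivalence classes.
\<close>

definition formal_sums :: "('k, 'v) module \<Rightarrow> ('k, 'w) module \<Rightarrow> ('v \<times> 'w) list set" where
  "formal_sums V W = lists (carrier V \<times> carrier W)"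

inductive tensor_eq ::
  "'k ring \<Rightarrow> ('k, 'v) module \<Rightarrow> ('k, 'w) module \<Rightarrow> ('v \<times> 'w) list \<Rightarrow> ('v \<times> 'w) list \<Rightarrow> bool"
  for K V W where
  refl: "xs \<in> formal_sums V W \<Longrightarrow> tensor_eq K V W xs xs"
| sym: "tensor_eq K V W xs ys \<Longrightarrow> tensor_eq K V W ys xs"
| trans: "tensor_eq K V W xs ys \<Longrightarrow> tensor_eq K V W ys zs \<Longrightarrow> tensor_eq K V W xs zs"
| append: "tensor_eq K V W xs xs' \<Longrightarrow> tensor_eq K V W ys ys' \<Longrightarrow> tensor_eq K V W (xs @ ys) (xs' @ ys')"
| comm: "xs \<in> formal_sums V W \<Longrightarrow> ys \<in> formal_sums V W \<Longrightarrow> tensor_eq K V W (xs @ ys) (ys @ xs)"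
| zero: "w \<in> carrier W \<Longrightarrow> tensor_eq K V W [(\<zero>\<^bsub>V\<^esub>, w)] []"
| add_left: "v \<in> carrier V \<Longrightarrow> v' \<in> carrier V \<Longrightarrow> w \<in> carrier W \<Longrightarrow>
    tensor_eq K V W [(v \<oplus>\<^bsub>V\<^esub> v', w)] [(v, w), (v', w)]"
| add_right: "v \<in> carrier V \<Longrightarrow> w \<in> carrier W \<Longrightarrow> w' \<in> carrier W \<Longrightarrow>
    tensor_eq K V W [(v, w \<oplus>\<^bsub>W\<^esub> w')] [(v, w), (v, w')]"
| balanced: "c \<in> carrier K \<Longrightarrow> v \<in> carrier V \<Longrightarrow> w \<in> carrier W \<Longrightarrow>
    tensor_eq K V W [(c \<odot>\<^bsub>V\<^esub> v, w)] [(v, c \<odot>\<^bsub>W\<^esub> w)]"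

type_synonym ('v, 'w) tensor = "('v \<times> 'w) list set"

definition tensor_class ::
  "'k ring \<Rightarrow> ('k, 'v) module \<Rightarrow> ('k, 'w) module \<Rightarrow> ('v \<times> 'w) list \<Rightarrow> ('v, 'w) tensor" where
  "tensor_class K V W xs = {ys. tensor_eq K V W xs ys}"

definition rep :: "('v, 'w) tensor \<Rightarrow> ('v \<times> 'w) list" where
  "rep t = (SOME xs. xs \<in> t)"

definition tens ::
  "'k ring \<Rightarrow> ('k, 'v) module \<Rightarrow> ('k, 'w) module \<Rightarrow> 'v \<Rightarrow> 'w \<Rightarrow> ('v, 'w) tensor" where
  "tens K V W v w = tensor_class K V W [(v, w)]"

text \<open>
  The multiplication and unit below are those of the tensor product of algebras,
  \<open>(v \<otimes> w)(v' \<otimes> w') = vv' \<otimes> ww'\<close>; they are meaningful only if \<open>V\<close> and \<open>W\<close> are algebras.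
  The underlying module of \<open>tensor K V W\<close> depends only on the underlying modules of \<open>V\<close> and \<open>W\<close>.
\<close>

definition tensor :: "'k ring \<Rightarrow> ('k, 'v) module \<Rightarrow> ('k, 'w) module \<Rightarrow> ('k, ('v, 'w) tensor) module" where
  "tensor K V W =
    \<lparr>carrier = tensor_class K V W ` formal_sums V W,
     mult = (\<lambda>s t. tensor_class K V W
       [(v \<otimes>\<^bsub>V\<^esub> v', w \<otimes>\<^bsub>W\<^esub> w'). (v, w) \<leftarrow> rep s, (v', w') \<leftarrow> rep t]),
     one = tens K V W \<one>\<^bsub>V\<^esub> \<one>\<^bsub>W\<^esub>,
     zero = tensor_class K V W [],
     add = (\<lambda>s t. tensor_class K V W (rep s @ rep t)),
     smult = (\<lambda>c t. tensor_class K V W [(c \<odot>\<^bsub>V\<^esub> v, w). (v, w) \<leftarrow> rep t])\<rparr>"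

text \<open>
  \<open>tsum U t f\<close> is the Sweedler-type sum \<open>\<Sum> f v w\<close> in \<open>U\<close> for \<open>t = \<Sum> v \<otimes> w\<close>, i.e. the value at
  \<open>t\<close> of the linear map \<open>V \<otimes> W \<rightarrow> U\<close> induced by the bilinear map \<open>f\<close>.  It does not depend on the
  representative of \<open>t\<close> when \<open>f\<close> is bilinear (lemma \<open>tsum_class\<close>).
\<close>

definition tsum :: "('k, 'u) module \<Rightarrow> ('v, 'w) tensor \<Rightarrow> ('v \<Rightarrow> 'w \<Rightarrow> 'u) \<Rightarrow> 'u" where
  "tsum U t f = foldr (\<lambda>(v, w) u. f v w \<oplus>\<^bsub>U\<^esub> u) (rep t) \<zero>\<^bsub>U\<^esub>"

subsection \<open>Universal property\<close>

text \<open>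
  \<open>tens\<close> is bilinear (\<open>tens_bilinear\<close>) and \<open>tsum\<close> is the factorization of bilinear maps through it
  (\<open>tsum_linear\<close>, \<open>tsum_tens\<close>).
\<close>

lemma tensor_eq_formal_sums:
  assumes "module K V" "module K W" "tensor_eq K V W xs ys"
  shows "xs \<in> formal_sums V W \<and> ys \<in> formal_sums V W"
proof -
  interpret V: module K V by fact
  interpret W: module K W by fact
  show ?thesis using assms(3)
    by induction (auto simp: formal_sums_def)
qed

lemma tensor_class_eq_iff:
  assumes "module K V" "module K W" "xs \<in> formal_sums V W"
  shows "tensor_class K V W xs = tensor_class K V W ys \<longleftrightarrow> tensor_eq K V W xs ys"
proof
  assume "tensor_class K V W xs = tensor_class K V W ys"
  then have "xs \<in> tensor_class K V W ys"
    using tensor_eq.refl[OF assms(3)] by (auto simp: tensor_class_def)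
  then show "tensor_eq K V W xs ys" by (auto simp: tensor_class_def intro: tensor_eq.sym)
next
  assume a: "tensor_eq K V W xs ys"
  show "tensor_class K V W xs = tensor_class K V W ys"
    unfolding tensor_class_def
    using tensor_eq.trans[OF a] tensor_eq.trans[OF tensor_eq.sym[OF a]] by blast
qed

lemma rep_class:
  assumes "module K V" "module K W" "xs \<in> formal_sums V W"
  shows "tensor_eq K V W xs (rep (tensor_class K V W xs))"
  unfolding rep_def tensor_class_def using assms(3)
  by (metis mem_Collect_eq someI tensor_eq.refl)

definition fsum ::
  "('k, 'u) module \<Rightarrow> ('v \<Rightarrow> 'w \<Rightarrow> 'u) \<Rightarrow> ('v \<times> 'w) list \<Rightarrow> 'u" where
  "fsum U f xs = foldr (\<lambda>(v, w) u. f v w \<oplus>\<^bsub>U\<^esub> u) xs \<zero>\<^bsub>U\<^esub>"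

lemma tsum_fsum: "tsum U t f = fsum U f (rep t)" by (simp add: tsum_def fsum_def)

context
  fixes K :: "'k ring" and U :: "('k,'u) module" and V :: "('k,'v) module" and W :: "('k,'w) module" and f
  assumes V: "module K V" and W: "module K W" and U: "module K U" and f: "bilinear_map K V W U f"
begin
interpretation V: module K V by (rule V)
interpretation W: module K W by (rule W)
interpretation U: module K U by (rule U)

lemma f_closed: "v \<in> carrier V \<Longrightarrow> w \<in> carrier W \<Longrightarrow> f v w \<in> carrier U"
  using f unfolding bilinear_map_def linear_map_def by auto

lemma f_zero: "w \<in> carrier W \<Longrightarrow> f \<zero>\<^bsub>V\<^esub> w = \<zero>\<^bsub>U\<^esub>"
proof -
  assume w: "w \<in> carrier W"
  have "f (\<zero>\<^bsub>K\<^esub> \<odot>\<^bsub>V\<^esub> \<zero>\<^bsub>V\<^esub>) w = \<zero>\<^bsub>K\<^esub> \<odot>\<^bsub>U\<^esub> f \<zero>\<^bsub>V\<^esub> w"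
    using f w unfolding bilinear_map_def linear_map_def by blast
  then show ?thesis using f_closed w by simp
qed

lemma fsum_closed: "xs \<in> formal_sums V W \<Longrightarrow> fsum U f xs \<in> carrier U"
  by (induct xs) (auto simp: fsum_def formal_sums_def f_closed)

lemma fsum_append: "xs \<in> formal_sums V W \<Longrightarrow> ys \<in> formal_sums V W \<Longrightarrow> 
   fsum U f (xs@ys) = fsum U f xs \<oplus>\<^bsub>U\<^esub> fsum U f ys"
proof (induct xs)
  case Nil then show ?case using fsum_closed by (simp add: fsum_def)
next
  case (Cons p xs)
  obtain v w where p: "p = (v,w)" by force
  have 1: "v \<in> carrier V" "w \<in> carrier W" "xs \<in> formal_sums V W" 
    using Cons p by (auto simp: formal_sums_def)
  show ?case using Cons(1)[OF 1(3) Cons(3)] fsum_closed[OF 1(3)] fsum_closed[OF Cons(3)] f_closed[OF 1(1,2)]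
    by (simp add: p fsum_def U.a_assoc)
qed

lemma fsum_eq: "tensor_eq K V W xs ys \<Longrightarrow> fsum U f xs = fsum U f ys"
proof (induction rule: tensor_eq.induct)
  case (append xs xs' ys ys')
  then show ?case using tensor_eq_formal_sums[OF V W append(1)] tensor_eq_formal_sums[OF V W append(2)]
    by (simp add: fsum_append)
next
  case (comm xs ys) then show ?case by (simp add: fsum_append fsum_closed U.a_comm)
next
  case (zero w) then show ?case by (simp add: fsum_def f_zero)
next
  case (add_left v v' w)
  then have "f (v \<oplus>\<^bsub>V\<^esub> v') w = f v w \<oplus>\<^bsub>U\<^esub> f v' w"
   using f unfolding bilinear_map_def linear_map_def by blast
  then show ?case using add_left by (simp add: fsum_def f_closed U.a_assoc)
next
  case (add_right v w w')
  then have "f v (w \<oplus>\<^bsub>W\<^esub> w') = f v w \<oplus>\<^bsub>U\<^esub> f v w'"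
   using f unfolding bilinear_map_def linear_map_def by blast
  then show ?case using add_right by (simp add: fsum_def f_closed U.a_assoc)
next
  case (balanced c v w)
  then have "f (c \<odot>\<^bsub>V\<^esub> v) w = f v (c \<odot>\<^bsub>W\<^esub> w)"
   using f unfolding bilinear_map_def linear_map_def by force
  then show ?case by (simp add: fsum_def)
qed auto

lemma tsum_class: "xs \<in> formal_sums V W \<Longrightarrow> 
  tsum U (tensor_class K V W xs) f = foldr (\<lambda>(v, w) u. f v w \<oplus>\<^bsub>U\<^esub> u) xs \<zero>\<^bsub>U\<^esub>"
  using fsum_eq[OF rep_class[OF V W]] by (simp add: tsum_fsum) (simp add: fsum_def)

lemma tsum_tens: "v \<in> carrier V \<Longrightarrow> w \<in> carrier W \<Longrightarrow> tsum U (tens K V W v w) f = f v w"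
  by (simp add: tens_def tsum_class formal_sums_def f_closed)

end

lemma smult_class:
  assumes V: "module K V" and W: "module K W" and c: "c \<in> carrier K" and "tensor_eq K V W xs ys"
  shows "tensor_eq K V W [(c \<odot>\<^bsub>V\<^esub> v, w). (v, w) \<leftarrow> xs] [(c \<odot>\<^bsub>V\<^esub> v, w). (v, w) \<leftarrow> ys]"
proof -
  interpret V: module K V by (rule V)
  interpret W: module K W by (rule W)
  let ?s = "\<lambda>xs. [(c \<odot>\<^bsub>V\<^esub> v, w). (v, w) \<leftarrow> xs]"
  have m: "?s xs \<in> formal_sums V W" if "xs \<in> formal_sums V W" for xs
    using that c by (induct xs) (auto simp: formal_sums_def)
  show ?thesis using assms(4)
  proof induction
    case (refl xs) then show ?case by (intro tensor_eq.refl m)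
  next case (sym xs ys) show ?case by (rule tensor_eq.sym[OF sym(2)])
  next case (trans xs ys zs) then show ?case using tensor_eq.trans by blast
  next case (append xs xs' ys ys') then show ?case using tensor_eq.append[OF append(3,4)] by simp
  next case (comm xs ys) then show ?case using tensor_eq.comm[OF m[OF comm(1)] m[OF comm(2)]] by simp
  next case (zero w) then show ?case using c by (simp add: tensor_eq.zero V.smult_r_null)
  next case (add_left v v' w) then show ?case using c by (simp add: V.smult_r_distr tensor_eq.add_left)
  next case (add_right v w w') then show ?case using c by (simp add: tensor_eq.add_right)
  next case (balanced d v w)
    have "c \<odot>\<^bsub>V\<^esub> (d \<odot>\<^bsub>V\<^esub> v) = d \<odot>\<^bsub>V\<^esub> (c \<odot>\<^bsub>V\<^esub> v)"
      using balanced c by (metis V.smult_assoc1 V.R.m_comm)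
    then show ?case using c balanced by (simp add: tensor_eq.balanced)
  qed
qed

lemma tensor_module: assumes V: "module K V" and W: "module K W" shows "module K (tensor K V W)"
proof -
  interpret V: module K V by (rule V)
  interpret W: module K W by (rule W)
  let ?T = "tensor K V W" and ?c = "tensor_class K V W" and ?F = "formal_sums V W"
  let ?s = "\<lambda>c xs. [(c \<odot>\<^bsub>V\<^esub> v, w). (v, w) \<leftarrow> xs]"
  note eqI = tensor_class_eq_iff[OF V W, THEN iffD2]
  have cl: "t \<in> carrier ?T \<longleftrightarrow> (\<exists>xs\<in>?F. t = ?c xs)" for t by (auto simp: tensor_def)
  have app: "xs @ ys \<in> ?F" if "xs \<in> ?F" "ys \<in> ?F" for xs ys using that by (auto simp: formal_sums_def)
  have cm: "?c (xs @ ys) = ?c (ys @ xs)" if "xs \<in> ?F" "ys \<in> ?F" for xs ys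
    by (rule eqI[OF app[OF that] tensor_eq.comm[OF that]])
  have nil: "[] \<in> ?F" by (auto simp: formal_sums_def)
  have sm: "?s c xs \<in> ?F" if "xs \<in> ?F" "c \<in> carrier K" for xs c using that by (induct xs) (auto simp: formal_sums_def)
  have z: "\<zero>\<^bsub>?T\<^esub> = ?c []" by (simp add: tensor_def)
  have ad: "?c xs \<oplus>\<^bsub>?T\<^esub> ?c ys = ?c (xs @ ys)" if "xs \<in> ?F" "ys \<in> ?F" for xs ys
    using eqI[OF app[OF that] tensor_eq.append[OF rep_class[OF V W that(1)] rep_class[OF V W that(2)]]]
    by (simp add: tensor_def)
  have smu: "c \<odot>\<^bsub>?T\<^esub> ?c xs = ?c (?s c xs)" if "xs \<in> ?F" "c \<in> carrier K" for xs c
    using eqI[OF sm[OF that] smult_class[OF V W that(2) rep_class[OF V W that(1)]]] by (simp add: tensor_def)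
  have neg: "tensor_eq K V W (?s (\<ominus>\<^bsub>K\<^esub> \<one>\<^bsub>K\<^esub>) xs @ xs) []" if "xs \<in> ?F" for xs using that
  proof (induct xs)
    case Nil show ?case by (simp add: tensor_eq.refl nil)
  next
    case (Cons p xs)
    obtain v w where p: "p = (v,w)" by force
    have 1: "v \<in> carrier V" "w \<in> carrier W" "xs \<in> ?F" using Cons p by (auto simp: formal_sums_def)
    let ?n = "\<ominus>\<^bsub>K\<^esub> \<one>\<^bsub>K\<^esub>"
    have n: "?n \<in> carrier K" by simp
    have nv: "?n \<odot>\<^bsub>V\<^esub> v \<oplus>\<^bsub>V\<^esub> v = \<zero>\<^bsub>V\<^esub>" using 1 
      by (simp add: V.smult_l_minus V.M.l_neg)
    have a: "tensor_eq K V W [(?n \<odot>\<^bsub>V\<^esub> v, w), (v,w)] []"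
      using tensor_eq.add_left[OF V.smult_closed[OF n 1(1)] 1(1,2)] tensor_eq.zero[OF 1(2)]
      unfolding nv by (metis tensor_eq.sym tensor_eq.trans)
    have b: "tensor_eq K V W ([(?n \<odot>\<^bsub>V\<^esub> v, w)] @ (?s ?n xs @ [(v,w)]) @ xs) ([(?n \<odot>\<^bsub>V\<^esub> v, w)] @ ([(v,w)] @ ?s ?n xs) @ xs)"
      by (intro tensor_eq.append tensor_eq.refl tensor_eq.comm sm 1 n) (use 1 n in \<open>auto simp: formal_sums_def\<close>)
    have c: "tensor_eq K V W ([(?n \<odot>\<^bsub>V\<^esub> v, w), (v,w)] @ (?s ?n xs @ xs)) ([] @ [])"
      by (intro tensor_eq.append a Cons(1) 1)
    show ?case using tensor_eq.trans[OF b] c by (simp add: p)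
  qed
  show ?thesis
  proof (rule moduleI)
    show "cring K" by (rule V.R.is_cring)
    show "abelian_group ?T"
    proof (rule abelian_groupI)
      show "\<exists>y\<in>carrier ?T. y \<oplus>\<^bsub>?T\<^esub> x = \<zero>\<^bsub>?T\<^esub>" if x: "x \<in> carrier ?T" for x
      proof -
        obtain xs where xs: "xs \<in> ?F" "x = ?c xs" using x cl by auto
        let ?n = "\<ominus>\<^bsub>K\<^esub> \<one>\<^bsub>K\<^esub>"
        have n: "?n \<in> carrier K" by simp
        have "?c (?s ?n xs) \<oplus>\<^bsub>?T\<^esub> x = ?c []" 
          unfolding xs(2) ad[OF sm[OF xs(1) n] xs(1)]
          by (rule eqI[OF app[OF sm[OF xs(1) n] xs(1)] neg[OF xs(1)]])
        then show ?thesis using cl sm[OF xs(1) n] z by auto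
      qed
    next
      show "\<zero>\<^bsub>?T\<^esub> \<in> carrier ?T" using nil z cl by blast
    next
      fix x y assume "x \<in> carrier ?T" "y \<in> carrier ?T"
      then show "x \<oplus>\<^bsub>?T\<^esub> y = y \<oplus>\<^bsub>?T\<^esub> x" using cm by (auto simp: cl ad)
    qed (use app nil in \<open>auto simp: cl z ad\<close>)

  next
    fix c x assume "c \<in> carrier K" "x \<in> carrier ?T"
    then show "c \<odot>\<^bsub>?T\<^esub> x \<in> carrier ?T" using smu sm by (auto simp: cl)
  next
    fix a b x assume ab: "a \<in> carrier K" "b \<in> carrier K" and x: "x \<in> carrier ?T"
    obtain xs where xs: "xs \<in> ?F" "x = ?c xs" using x cl by auto
    have "tensor_eq K V W (?s (a \<oplus>\<^bsub>K\<^esub> b) xs) (?s a xs @ ?s b xs)" using xs(1)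
    proof (induct xs)
      case Nil show ?case by (simp add: tensor_eq.refl nil)
    next
      case (Cons p xs)
      obtain v w where p: "p = (v,w)" by force
      have 1: "v \<in> carrier V" "w \<in> carrier W" "xs \<in> ?F" using Cons p by (auto simp: formal_sums_def)
      have A: "tensor_eq K V W [((a \<oplus>\<^bsub>K\<^esub> b) \<odot>\<^bsub>V\<^esub> v, w)] [(a \<odot>\<^bsub>V\<^esub> v, w), (b \<odot>\<^bsub>V\<^esub> v, w)]"
        using tensor_eq.add_left[OF V.smult_closed[OF ab(1) 1(1)] V.smult_closed[OF ab(2) 1(1)] 1(2)]
        by (simp add: V.smult_l_distr ab 1)
      have B: "tensor_eq K V W ([(a \<odot>\<^bsub>V\<^esub> v, w)] @ ([(b \<odot>\<^bsub>V\<^esub> v, w)] @ ?s a xs) @ ?s b xs)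
         ([(a \<odot>\<^bsub>V\<^esub> v, w)] @ (?s a xs @ [(b \<odot>\<^bsub>V\<^esub> v, w)]) @ ?s b xs)"
        by (intro tensor_eq.append tensor_eq.refl tensor_eq.comm sm 1 ab) (use 1 ab in \<open>auto simp: formal_sums_def\<close>)
      show ?case using tensor_eq.trans[OF tensor_eq.append[OF A Cons(1)[OF 1(3)]], of "([(a \<odot>\<^bsub>V\<^esub> v, w)] @ (?s a xs @ [(b \<odot>\<^bsub>V\<^esub> v, w)]) @ ?s b xs)"] B
        by (simp add: p)
    qed
    then show "(a \<oplus>\<^bsub>K\<^esub> b) \<odot>\<^bsub>?T\<^esub> x = a \<odot>\<^bsub>?T\<^esub> x \<oplus>\<^bsub>?T\<^esub> b \<odot>\<^bsub>?T\<^esub> x"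
      unfolding xs(2) smu[OF xs(1) ab(1)] smu[OF xs(1) ab(2)] smu[OF xs(1) V.R.a_closed[OF ab]]
        ad[OF sm[OF xs(1) ab(1)] sm[OF xs(1) ab(2)]]
      by (rule eqI[OF sm[OF xs(1) V.R.a_closed[OF ab]]])
  next
    fix a x y assume a: "a \<in> carrier K" and x: "x \<in> carrier ?T" and y: "y \<in> carrier ?T"
    then obtain xs ys where xy: "xs \<in> ?F" "x = ?c xs" "ys \<in> ?F" "y = ?c ys" using cl by auto
    show "a \<odot>\<^bsub>?T\<^esub> (x \<oplus>\<^bsub>?T\<^esub> y) = a \<odot>\<^bsub>?T\<^esub> x \<oplus>\<^bsub>?T\<^esub> a \<odot>\<^bsub>?T\<^esub> y"
      unfolding xy(2,4) by (simp only: ad smu a xy sm app map_append)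
  next
    fix a b x assume ab: "a \<in> carrier K" "b \<in> carrier K" and x: "x \<in> carrier ?T"
    obtain xs where xs: "xs \<in> ?F" "x = ?c xs" using x cl by auto
    have "?s (a \<otimes>\<^bsub>K\<^esub> b) xs = ?s a (?s b xs)" using xs(1) ab
      by (induct xs) (auto simp: formal_sums_def V.smult_assoc1)
    then show "(a \<otimes>\<^bsub>K\<^esub> b) \<odot>\<^bsub>?T\<^esub> x = a \<odot>\<^bsub>?T\<^esub> (b \<odot>\<^bsub>?T\<^esub> x)"
      unfolding xs(2) by (simp only: smu xs(1) ab sm V.R.m_closed)
  next
    fix x assume x: "x \<in> carrier ?T"
    obtain xs where xs: "xs \<in> ?F" "x = ?c xs" using x cl by auto
    have "?s \<one>\<^bsub>K\<^esub> xs = xs" using xs(1) 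
      by (induct xs) (auto simp: formal_sums_def)
    then show "\<one>\<^bsub>K\<^esub> \<odot>\<^bsub>?T\<^esub> x = x"
      unfolding xs(2) by (simp only: smu xs(1) V.R.one_closed)
  qed
qed

lemma tens_bilinear: assumes V: "module K V" and W: "module K W"
  shows "bilinear_map K V W (tensor K V W) (tens K V W)"
proof -
  interpret V: module K V by (rule V)
  interpret W: module K W by (rule W)
  let ?T = "tensor K V W" and ?c = "tensor_class K V W" and ?F = "formal_sums V W"
  note eqI = tensor_class_eq_iff[OF V W, THEN iffD2]
  have F: "v \<in> carrier V \<Longrightarrow> w \<in> carrier W \<Longrightarrow> [(v,w)] \<in> ?F" for v w by (simp add: formal_sums_def)
  have cl: "v \<in> carrier V \<Longrightarrow> w \<in> carrier W \<Longrightarrow> tens K V W v w \<in> carrier ?T" for v w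
    using F by (auto simp: tensor_def tens_def)
  have F2: "xs \<in> ?F \<Longrightarrow> ys \<in> ?F \<Longrightarrow> xs @ ys \<in> ?F" for xs ys by (simp add: formal_sums_def)
  have ad: "?c xs \<oplus>\<^bsub>?T\<^esub> ?c ys = ?c (xs @ ys)" if "xs \<in> ?F" "ys \<in> ?F" for xs ys
    using eqI[OF F2[OF that] tensor_eq.append[OF rep_class[OF V W that(1)] rep_class[OF V W that(2)]]]
    by (simp add: tensor_def)
  have smu: "c \<odot>\<^bsub>?T\<^esub> tens K V W v w = tens K V W (c \<odot>\<^bsub>V\<^esub> v) w"
    if "c \<in> carrier K" "v \<in> carrier V" "w \<in> carrier W" for c v w
  proof -
    have "tensor_eq K V W [(c \<odot>\<^bsub>V\<^esub> v, w)] [(c \<odot>\<^bsub>V\<^esub> v, w). (v, w) \<leftarrow> rep (?c [(v,w)])]"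
      using smult_class[OF V W that(1) rep_class[OF V W F[OF that(2,3)]]] by simp
    from eqI[OF F[OF V.smult_closed[OF that(1,2)] that(3)] this] show ?thesis
      by (simp add: tensor_def tens_def)
  qed
  have bal: "tens K V W (c \<odot>\<^bsub>V\<^esub> v) w = tens K V W v (c \<odot>\<^bsub>W\<^esub> w)"
    if "c \<in> carrier K" "v \<in> carrier V" "w \<in> carrier W" for c v w
    unfolding tens_def by (rule eqI[OF F[OF V.smult_closed[OF that(1,2)] that(3)] tensor_eq.balanced[OF that]])
  have l: "tens K V W (v \<oplus>\<^bsub>V\<^esub> v') w = tens K V W v w \<oplus>\<^bsub>?T\<^esub> tens K V W v' w"
    if "v \<in> carrier V" "v' \<in> carrier V" "w \<in> carrier W" for v v' w
    unfolding tens_def ad[OF F[OF that(1,3)] F[OF that(2,3)]]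
    using eqI[OF F[OF V.a_closed[OF that(1,2)] that(3)] tensor_eq.add_left[OF that]] by simp
  have r: "tens K V W v (w \<oplus>\<^bsub>W\<^esub> w') = tens K V W v w \<oplus>\<^bsub>?T\<^esub> tens K V W v w'"
    if "v \<in> carrier V" "w \<in> carrier W" "w' \<in> carrier W" for v w w'
    unfolding tens_def ad[OF F[OF that(1,2)] F[OF that(1,3)]]
    using eqI[OF F[OF that(1) W.a_closed[OF that(2,3)]] tensor_eq.add_right[OF that]] by simp
  show ?thesis unfolding bilinear_map_def linear_map_def
    by (intro conjI ballI Pi_I) (simp_all only: cl l r smu bal[symmetric])
qed

lemma tsum_linear: assumes V: "module K V" and W: "module K W" and U: "module K U"
  and f: "bilinear_map K V W U f"
  shows "linear_map K (tensor K V W) U (\<lambda>t. tsum U t f)"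
proof -
  interpret V: module K V by (rule V)
  interpret W: module K W by (rule W)
  interpret U: module K U by (rule U)
  let ?T = "tensor K V W" and ?c = "tensor_class K V W" and ?F = "formal_sums V W"
  let ?s = "\<lambda>c xs. [(c \<odot>\<^bsub>V\<^esub> v, w). (v, w) \<leftarrow> xs]"
  note eqI = tensor_class_eq_iff[OF V W, THEN iffD2]
  note closed = fsum_closed[OF V W U f]
  have ts: "tsum U (?c xs) f = fsum U f xs" if "xs \<in> ?F" for xs
    using tsum_class[OF V W U f that] by (simp add: fsum_def)
  have F2: "xs \<in> ?F \<Longrightarrow> ys \<in> ?F \<Longrightarrow> xs @ ys \<in> ?F" for xs ys by (simp add: formal_sums_def)
  have sm: "?s c xs \<in> ?F" if "xs \<in> ?F" "c \<in> carrier K" for xs c using that by (induct xs) (auto simp: formal_sums_def)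
  have cl: "t \<in> carrier ?T \<longleftrightarrow> (\<exists>xs\<in>?F. t = ?c xs)" for t by (auto simp: tensor_def)
  have ad: "?c xs \<oplus>\<^bsub>?T\<^esub> ?c ys = ?c (xs @ ys)" if "xs \<in> ?F" "ys \<in> ?F" for xs ys
    using eqI[OF F2[OF that] tensor_eq.append[OF rep_class[OF V W that(1)] rep_class[OF V W that(2)]]]
    by (simp add: tensor_def)
  have smu: "c \<odot>\<^bsub>?T\<^esub> ?c xs = ?c (?s c xs)" if "xs \<in> ?F" "c \<in> carrier K" for xs c
    using eqI[OF sm[OF that] smult_class[OF V W that(2) rep_class[OF V W that(1)]]] by (simp add: tensor_def)
  have sf: "fsum U f (?s c xs) = c \<odot>\<^bsub>U\<^esub> fsum U f xs" if "xs \<in> ?F" "c \<in> carrier K" for xs c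
    using that(1)
  proof (induct xs)
    case Nil show ?case by (simp add: fsum_def that(2))
  next
    case (Cons p xs)
    obtain v w where p: "p = (v,w)" by force
    have 1: "v \<in> carrier V" "w \<in> carrier W" "xs \<in> ?F" using Cons p by (auto simp: formal_sums_def)
    have "f (c \<odot>\<^bsub>V\<^esub> v) w = c \<odot>\<^bsub>U\<^esub> f v w" using f 1 that(2) unfolding bilinear_map_def linear_map_def by blast
    then show ?case using Cons(1)[OF 1(3)] closed[OF 1(3)] f_closed[OF V W U f 1(1,2)] that(2)
      by (simp add: p fsum_def U.smult_r_distr)
  qed
  show ?thesis unfolding linear_map_def
  proof (intro conjI ballI Pi_I)
    fix t assume "t \<in> carrier ?T" then show "tsum U t f \<in> carrier U" using closed ts cl by auto
  next
    fix s t assume "s \<in> carrier ?T" "t \<in> carrier ?T"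
    then obtain xs ys where x: "xs \<in> ?F" "s = ?c xs" "ys \<in> ?F" "t = ?c ys" using cl by auto
    show "tsum U (s \<oplus>\<^bsub>?T\<^esub> t) f = tsum U s f \<oplus>\<^bsub>U\<^esub> tsum U t f"
      unfolding x(2,4) by (simp only: ad ts x F2 fsum_append[OF V W U f])
  next
    fix c t assume c: "c \<in> carrier K" and "t \<in> carrier ?T"
    then obtain xs where x: "xs \<in> ?F" "t = ?c xs" using cl by auto
    show "tsum U (c \<odot>\<^bsub>?T\<^esub> t) f = c \<odot>\<^bsub>U\<^esub> tsum U t f"
      unfolding x(2) by (simp only: smu ts x c sm sf)
  qed
qed


subsection \<open>Operations on tensor products\<close>

text \<open>Iterated tensor products are bracketed to the left.\<close>

abbreviation tensor3 where
  "tensor3 K U V W \<equiv> tensor K (tensor K U V) W"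

abbreviation tens3 where
  "tens3 K U V W u v w \<equiv> tens K (tensor K U V) W (tens K U V u v) w"

definition tsum3 ::
  "('k, 'u) module \<Rightarrow> (('x, 'y) tensor, 'z) tensor \<Rightarrow> ('x \<Rightarrow> 'y \<Rightarrow> 'z \<Rightarrow> 'u) \<Rightarrow> 'u" where
  "tsum3 U t f = tsum U t (\<lambda>s z. tsum U s (\<lambda>x y. f x y z))"

definition tmap ::
  "'k ring \<Rightarrow> ('k, 'v') module \<Rightarrow> ('k, 'w') module \<Rightarrow> ('v \<Rightarrow> 'v') \<Rightarrow> ('w \<Rightarrow> 'w') \<Rightarrow>
   ('v, 'w) tensor \<Rightarrow> ('v', 'w') tensor" where
  "tmap K V' W' f g t = tsum (tensor K V' W') t (\<lambda>v w. tens K V' W' (f v) (g w))"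

definition assoc_right ::
  "'k ring \<Rightarrow> ('k, 'u) module \<Rightarrow> ('k, 'v) module \<Rightarrow> ('k, 'w) module \<Rightarrow>
   (('u, 'v) tensor, 'w) tensor \<Rightarrow> ('u, ('v, 'w) tensor) tensor" where
  "assoc_right K U V W t =
    tsum3 (tensor K U (tensor K V W)) t (\<lambda>u v w. tens K U (tensor K V W) u (tens K V W v w))"

definition assoc_left ::
  "'k ring \<Rightarrow> ('k, 'u) module \<Rightarrow> ('k, 'v) module \<Rightarrow> ('k, 'w) module \<Rightarrow>
   ('u, ('v, 'w) tensor) tensor \<Rightarrow> (('u, 'v) tensor, 'w) tensor" where
  "assoc_left K U V W t =
    tsum (tensor3 K U V W) t (\<lambda>u s. tsum (tensor3 K U V W) s (\<lambda>v w. tens3 K U V W u v w))"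

text \<open>\<open>id \<otimes> \<epsilon>\<close> and \<open>\<epsilon> \<otimes> id\<close>, with \<open>V \<otimes> K\<close> and \<open>K \<otimes> V\<close> identified with \<open>V\<close>.\<close>

definition id_tensor_counit :: "('k, 'v) module \<Rightarrow> ('h \<Rightarrow> 'k) \<Rightarrow> ('v, 'h) tensor \<Rightarrow> 'v" where
  "id_tensor_counit V \<epsilon> t = tsum V t (\<lambda>v h. \<epsilon> h \<odot>\<^bsub>V\<^esub> v)"

definition counit_tensor_id :: "('k, 'v) module \<Rightarrow> ('h \<Rightarrow> 'k) \<Rightarrow> ('h, 'v) tensor \<Rightarrow> 'v" where
  "counit_tensor_id V \<epsilon> t = tsum V t (\<lambda>h v. \<epsilon> h \<odot>\<^bsub>V\<^esub> v)"


section \<open>Algebras\<close>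

definition assoc_algebra :: "'k ring \<Rightarrow> ('k, 'a) module \<Rightarrow> bool" where
  "assoc_algebra K A \<longleftrightarrow> field K \<and> module K A \<and> ring A \<and> bilinear_map K A A A (mult A)"

definition unital_nonassoc_algebra :: "'k ring \<Rightarrow> ('k, 'a) module \<Rightarrow> bool" where
  "unital_nonassoc_algebra K A \<longleftrightarrow> field K \<and> module K A \<and> bilinear_map K A A A (mult A) \<and>
    \<one>\<^bsub>A\<^esub> \<in> carrier A \<and> (\<forall>a\<in>carrier A. \<one>\<^bsub>A\<^esub> \<otimes>\<^bsub>A\<^esub> a = a \<and> a \<otimes>\<^bsub>A\<^esub> \<one>\<^bsub>A\<^esub> = a)"

definition algebra_hom :: "'k ring \<Rightarrow> ('k, 'a) module \<Rightarrow> ('k, 'b) module \<Rightarrow> ('a \<Rightarrow> 'b) set" where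
  "algebra_hom K A B = {f \<in> ring_hom A B. linear_map K A B f}"

definition algebra_iso :: "'k ring \<Rightarrow> ('k, 'a) module \<Rightarrow> ('k, 'b) module \<Rightarrow> ('a \<Rightarrow> 'b) set" where
  "algebra_iso K A B = {f \<in> algebra_hom K A B. bij_betw f (carrier A) (carrier B)}"


section \<open>Quasi-bialgebras, comodule algebras and bimodule algebras\<close>

text \<open>
  \<open>A\<close>, \<open>B\<close>, \<open>M\<close> stand for \<open>\<AA>\<close>, \<open>\<BB>\<close>, \<open>\<A>\<close>, and \<open>\<Lambda>\<close> for the left coaction usually written with a
  small lambda.  All identities in threefold and fourfold tensor products are stated in the
  left-bracketed product; \<open>assoc_left\<close> supplies the rebracketing.
\<close>

locale quasi_bialgebra =
  fixes K :: "'k ring" and H :: "('k, 'h) module"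
    and \<Delta> :: "'h \<Rightarrow> ('h, 'h) tensor" and \<epsilon> :: "'h \<Rightarrow> 'k"
    and \<Phi> :: "(('h, 'h) tensor, 'h) tensor"
  assumes H_algebra: "assoc_algebra K H"
    and comult_hom: "\<Delta> \<in> algebra_hom K H (tensor K H H)"
    and counit_hom: "\<epsilon> \<in> ring_hom H K"
    and counit_smult: "\<And>c h. c \<in> carrier K \<Longrightarrow> h \<in> carrier H \<Longrightarrow> \<epsilon> (c \<odot>\<^bsub>H\<^esub> h) = c \<otimes>\<^bsub>K\<^esub> \<epsilon> h"
    and reassociator_unit: "\<Phi> \<in> Units (tensor3 K H H H)"
    and quasi_coassoc: "\<And>h. h \<in> carrier H \<Longrightarrow>
      assoc_left K H H H (tmap K H (tensor K H H) id \<Delta> (\<Delta> h)) =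
      \<Phi> \<otimes>\<^bsub>tensor3 K H H H\<^esub> tmap K (tensor K H H) H \<Delta> id (\<Delta> h)
        \<otimes>\<^bsub>tensor3 K H H H\<^esub> inv\<^bsub>tensor3 K H H H\<^esub> \<Phi>"
    and counit_right: "\<And>h. h \<in> carrier H \<Longrightarrow> id_tensor_counit H \<epsilon> (\<Delta> h) = h"
    and counit_left: "\<And>h. h \<in> carrier H \<Longrightarrow> counit_tensor_id H \<epsilon> (\<Delta> h) = h"
    and pentagon:
      "tmap K (tensor3 K H H H) H (assoc_left K H H H) id
           (assoc_left K H (tensor K H H) H (tens K H (tensor3 K H H H) \<one>\<^bsub>H\<^esub> \<Phi>))
         \<otimes>\<^bsub>tensor K (tensor3 K H H H) H\<^esub>
           tmap K (tensor3 K H H H) H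
             (\<lambda>s. assoc_left K H H H (tmap K H (tensor K H H) id \<Delta> s)) id \<Phi>
         \<otimes>\<^bsub>tensor K (tensor3 K H H H) H\<^esub>
           tens K (tensor3 K H H H) H \<Phi> \<one>\<^bsub>H\<^esub>
       = assoc_left K (tensor K H H) H H (tmap K (tensor K H H) (tensor K H H) id \<Delta> \<Phi>)
         \<otimes>\<^bsub>tensor K (tensor3 K H H H) H\<^esub>
           tmap K (tensor3 K H H H) H (tmap K (tensor K H H) H \<Delta> id) id \<Phi>"
    and reassociator_counit:
      "tmap K H H (id_tensor_counit H \<epsilon>) id \<Phi> = \<one>\<^bsub>tensor K H H\<^esub>"

locale right_comodule_algebra = quasi_bialgebra K H \<Delta> \<epsilon> \<Phi>
  for K :: "'k ring" and H :: "('k, 'h) module" and \<Delta> \<epsilon> \<Phi> +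
  fixes A :: "('k, 'a) module" and \<rho> :: "'a \<Rightarrow> ('a, 'h) tensor"
    and \<Phi>\<^sub>\<rho> :: "(('a, 'h) tensor, 'h) tensor"
  assumes A_algebra: "assoc_algebra K A"
    and right_coaction_hom: "\<rho> \<in> algebra_hom K A (tensor K A H)"
    and right_coaction_reassociator_unit: "\<Phi>\<^sub>\<rho> \<in> Units (tensor3 K A H H)"
    and right_coaction_quasi_coassoc: "\<And>a. a \<in> carrier A \<Longrightarrow>
      \<Phi>\<^sub>\<rho> \<otimes>\<^bsub>tensor3 K A H H\<^esub> tmap K (tensor K A H) H \<rho> id (\<rho> a) =
      assoc_left K A H H (tmap K A (tensor K H H) id \<Delta> (\<rho> a)) \<otimes>\<^bsub>tensor3 K A H H\<^esub> \<Phi>\<^sub>\<rho>"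
    and right_coaction_pentagon:
      "tmap K (tensor3 K A H H) H (assoc_left K A H H) id
           (assoc_left K A (tensor K H H) H (tens K A (tensor3 K H H H) \<one>\<^bsub>A\<^esub> \<Phi>))
         \<otimes>\<^bsub>tensor K (tensor3 K A H H) H\<^esub>
           tmap K (tensor3 K A H H) H
             (\<lambda>s. assoc_left K A H H (tmap K A (tensor K H H) id \<Delta> s)) id \<Phi>\<^sub>\<rho>
         \<otimes>\<^bsub>tensor K (tensor3 K A H H) H\<^esub>
           tens K (tensor3 K A H H) H \<Phi>\<^sub>\<rho> \<one>\<^bsub>H\<^esub>
       = assoc_left K (tensor K A H) H H (tmap K (tensor K A H) (tensor K H H) id \<Delta> \<Phi>\<^sub>\<rho>)
         \<otimes>\<^bsub>tensor K (tensor3 K A H H) H\<^esub>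
           tmap K (tensor3 K A H H) H (tmap K (tensor K A H) H \<rho> id) id \<Phi>\<^sub>\<rho>"
    and right_coaction_counit: "\<And>a. a \<in> carrier A \<Longrightarrow> id_tensor_counit A \<epsilon> (\<rho> a) = a"
    and right_coaction_reassociator_counit_middle:
      "tmap K A H (id_tensor_counit A \<epsilon>) id \<Phi>\<^sub>\<rho> = \<one>\<^bsub>tensor K A H\<^esub>"
    and right_coaction_reassociator_counit_right:
      "id_tensor_counit (tensor K A H) \<epsilon> \<Phi>\<^sub>\<rho> = \<one>\<^bsub>tensor K A H\<^esub>"

locale left_comodule_algebra = quasi_bialgebra K H \<Delta> \<epsilon> \<Phi>
  for K :: "'k ring" and H :: "('k, 'h) module" and \<Delta> \<epsilon> \<Phi> +
  fixes B :: "('k, 'b) module" and \<Lambda> :: "'b \<Rightarrow> ('h, 'b) tensor"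
    and \<Phi>\<^sub>\<Lambda> :: "(('h, 'h) tensor, 'b) tensor"
  assumes B_algebra: "assoc_algebra K B"
    and left_coaction_hom: "\<Lambda> \<in> algebra_hom K B (tensor K H B)"
    and left_coaction_reassociator_unit: "\<Phi>\<^sub>\<Lambda> \<in> Units (tensor3 K H H B)"
    and left_coaction_quasi_coassoc: "\<And>b. b \<in> carrier B \<Longrightarrow>
      assoc_left K H H B (tmap K H (tensor K H B) id \<Lambda> (\<Lambda> b)) \<otimes>\<^bsub>tensor3 K H H B\<^esub> \<Phi>\<^sub>\<Lambda> =
      \<Phi>\<^sub>\<Lambda> \<otimes>\<^bsub>tensor3 K H H B\<^esub> tmap K (tensor K H H) B \<Delta> id (\<Lambda> b)"
    and left_coaction_pentagon:
      "tmap K (tensor3 K H H H) B (assoc_left K H H H) id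
           (assoc_left K H (tensor K H H) B (tens K H (tensor3 K H H B) \<one>\<^bsub>H\<^esub> \<Phi>\<^sub>\<Lambda>))
         \<otimes>\<^bsub>tensor K (tensor3 K H H H) B\<^esub>
           tmap K (tensor3 K H H H) B
             (\<lambda>s. assoc_left K H H H (tmap K H (tensor K H H) id \<Delta> s)) id \<Phi>\<^sub>\<Lambda>
         \<otimes>\<^bsub>tensor K (tensor3 K H H H) B\<^esub>
           tens K (tensor3 K H H H) B \<Phi> \<one>\<^bsub>B\<^esub>
       = assoc_left K (tensor K H H) H B (tmap K (tensor K H H) (tensor K H B) id \<Lambda> \<Phi>\<^sub>\<Lambda>)
         \<otimes>\<^bsub>tensor K (tensor3 K H H H) B\<^esub>
           tmap K (tensor3 K H H H) B (tmap K (tensor K H H) H \<Delta> id) id \<Phi>\<^sub>\<Lambda>"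
    and left_coaction_counit: "\<And>b. b \<in> carrier B \<Longrightarrow> counit_tensor_id B \<epsilon> (\<Lambda> b) = b"
    and left_coaction_reassociator_counit_middle:
      "tmap K H B (id_tensor_counit H \<epsilon>) id \<Phi>\<^sub>\<Lambda> = \<one>\<^bsub>tensor K H B\<^esub>"
    and left_coaction_reassociator_counit_left:
      "tmap K H B (counit_tensor_id H \<epsilon>) id \<Phi>\<^sub>\<Lambda> = \<one>\<^bsub>tensor K H B\<^esub>"

text \<open>
  \<open>l h m\<close> is the left action \<open>h \<cdot> m\<close> and \<open>r m h\<close> is the right action \<open>m \<cdot> h\<close>.
\<close>

locale bimodule_algebra = quasi_bialgebra K H \<Delta> \<epsilon> \<Phi>
  for K :: "'k ring" and H :: "('k, 'h) module" and \<Delta> \<epsilon> \<Phi> +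
  fixes M :: "('k, 'm) module" and l :: "'h \<Rightarrow> 'm \<Rightarrow> 'm" and r :: "'m \<Rightarrow> 'h \<Rightarrow> 'm"
  assumes M_algebra: "unital_nonassoc_algebra K M"
    and left_bilinear: "bilinear_map K H M M l"
    and right_bilinear: "bilinear_map K M H M r"
    and left_mult: "\<And>h h' m. h \<in> carrier H \<Longrightarrow> h' \<in> carrier H \<Longrightarrow> m \<in> carrier M \<Longrightarrow>
      l (h \<otimes>\<^bsub>H\<^esub> h') m = l h (l h' m)"
    and left_one: "\<And>m. m \<in> carrier M \<Longrightarrow> l \<one>\<^bsub>H\<^esub> m = m"
    and right_mult: "\<And>h h' m. h \<in> carrier H \<Longrightarrow> h' \<in> carrier H \<Longrightarrow> m \<in> carrier M \<Longrightarrow>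
      r m (h \<otimes>\<^bsub>H\<^esub> h') = r (r m h) h'"
    and right_one: "\<And>m. m \<in> carrier M \<Longrightarrow> r m \<one>\<^bsub>H\<^esub> = m"
    and left_right: "\<And>h h' m. h \<in> carrier H \<Longrightarrow> h' \<in> carrier H \<Longrightarrow> m \<in> carrier M \<Longrightarrow>
      r (l h m) h' = l h (r m h')"
    and quasi_assoc: "\<And>m m' m''. m \<in> carrier M \<Longrightarrow> m' \<in> carrier M \<Longrightarrow> m'' \<in> carrier M \<Longrightarrow>
      (m \<otimes>\<^bsub>M\<^esub> m') \<otimes>\<^bsub>M\<^esub> m'' =
      tsum3 M \<Phi> (\<lambda>X1 X2 X3. tsum3 M (inv\<^bsub>tensor3 K H H H\<^esub> \<Phi>) (\<lambda>x1 x2 x3.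
        r (l X1 m) x1 \<otimes>\<^bsub>M\<^esub> (r (l X2 m') x2 \<otimes>\<^bsub>M\<^esub> r (l X3 m'') x3)))"
    and left_prod: "\<And>h m m'. h \<in> carrier H \<Longrightarrow> m \<in> carrier M \<Longrightarrow> m' \<in> carrier M \<Longrightarrow>
      l h (m \<otimes>\<^bsub>M\<^esub> m') = tsum M (\<Delta> h) (\<lambda>h1 h2. l h1 m \<otimes>\<^bsub>M\<^esub> l h2 m')"
    and right_prod: "\<And>h m m'. h \<in> carrier H \<Longrightarrow> m \<in> carrier M \<Longrightarrow> m' \<in> carrier M \<Longrightarrow>
      r (m \<otimes>\<^bsub>M\<^esub> m') h = tsum M (\<Delta> h) (\<lambda>h1 h2. r m h1 \<otimes>\<^bsub>M\<^esub> r m' h2)"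
    and left_unit: "\<And>h. h \<in> carrier H \<Longrightarrow> l h \<one>\<^bsub>M\<^esub> = \<epsilon> h \<odot>\<^bsub>M\<^esub> \<one>\<^bsub>M\<^esub>"
    and right_unit: "\<And>h. h \<in> carrier H \<Longrightarrow> r \<one>\<^bsub>M\<^esub> h = \<epsilon> h \<odot>\<^bsub>M\<^esub> \<one>\<^bsub>M\<^esub>"


section \<open>Smash products and crossed products\<close>

text \<open>
  Each product lives on the tensor product of the underlying modules, with unit \<open>1 \<otimes> 1\<close> (already
  provided by \<open>tensor\<close>), so only the multiplication is replaced.  The sums run over
  \<open>\<rho>(a') = a0 \<otimes> a1\<close>, \<open>\<Lambda>(b) = b1 \<otimes> b0\<close>, and the inverses \<open>y1 \<otimes> y2 \<otimes> y3\<close> of \<open>\<Phi>\<^sub>\<rho>\<close>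
  and \<open>x1 \<otimes> x2 \<otimes> x3\<close> of \<open>\<Phi>\<^sub>\<Lambda>\<close>.
\<close>

text \<open>\<open>\<AA> # \<A>\<close> with its left \<open>H\<close>-action\<close>

definition quasi_smash_left ::
  "'k ring \<Rightarrow> ('k, 'h) module \<Rightarrow> ('k, 'a) module \<Rightarrow> ('a \<Rightarrow> ('a, 'h) tensor) \<Rightarrow>
   (('a, 'h) tensor, 'h) tensor \<Rightarrow> ('k, 'm) module \<Rightarrow> ('m \<Rightarrow> 'h \<Rightarrow> 'm) \<Rightarrow> ('k, ('a, 'm) tensor) module" where
  "quasi_smash_left K H A \<rho> \<Phi>\<^sub>\<rho> M r = (let T = tensor K A M in
    T\<lparr>mult := (\<lambda>s t.
      tsum T s (\<lambda>a m. tsum T t (\<lambda>a' m'.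
      tsum T (\<rho> a') (\<lambda>a0 a1. tsum3 T (inv\<^bsub>tensor3 K A H H\<^esub> \<Phi>\<^sub>\<rho>) (\<lambda>y1 y2 y3.
        tens K A M
          (a \<otimes>\<^bsub>A\<^esub> a0 \<otimes>\<^bsub>A\<^esub> y1)
          (r m (a1 \<otimes>\<^bsub>H\<^esub> y2) \<otimes>\<^bsub>M\<^esub> r m' y3))))))\<rparr>)"

definition quasi_smash_left_action ::
  "'k ring \<Rightarrow> ('k, 'a) module \<Rightarrow> ('k, 'm) module \<Rightarrow> ('h \<Rightarrow> 'm \<Rightarrow> 'm) \<Rightarrow>
   'h \<Rightarrow> ('a, 'm) tensor \<Rightarrow> ('a, 'm) tensor" where
  "quasi_smash_left_action K A M l h = tmap K A M id (l h)"

text \<open>\<open>\<A> # \<BB>\<close> with its right \<open>H\<close>-action\<close>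

definition quasi_smash_right ::
  "'k ring \<Rightarrow> ('k, 'h) module \<Rightarrow> ('k, 'm) module \<Rightarrow> ('h \<Rightarrow> 'm \<Rightarrow> 'm) \<Rightarrow>
   ('k, 'b) module \<Rightarrow> ('b \<Rightarrow> ('h, 'b) tensor) \<Rightarrow> (('h, 'h) tensor, 'b) tensor \<Rightarrow>
   ('k, ('m, 'b) tensor) module" where
  "quasi_smash_right K H M l B \<Lambda> \<Phi>\<^sub>\<Lambda> = (let T = tensor K M B in
    T\<lparr>mult := (\<lambda>s t.
      tsum T s (\<lambda>m b. tsum T t (\<lambda>m' b'.
      tsum T (\<Lambda> b) (\<lambda>b1 b0. tsum3 T (inv\<^bsub>tensor3 K H H B\<^esub> \<Phi>\<^sub>\<Lambda>) (\<lambda>x1 x2 x3.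
        tens K M B
          (l x1 m \<otimes>\<^bsub>M\<^esub> l (x2 \<otimes>\<^bsub>H\<^esub> b1) m')
          (x3 \<otimes>\<^bsub>B\<^esub> b0 \<otimes>\<^bsub>B\<^esub> b'))))))\<rparr>)"

definition quasi_smash_right_action ::
  "'k ring \<Rightarrow> ('k, 'm) module \<Rightarrow> ('k, 'b) module \<Rightarrow> ('m \<Rightarrow> 'h \<Rightarrow> 'm) \<Rightarrow>
   ('m, 'b) tensor \<Rightarrow> 'h \<Rightarrow> ('m, 'b) tensor" where
  "quasi_smash_right_action K M B r t h = tmap K M B (\<lambda>m. r m h) id t"

text \<open>
  \<open>A \<blacktriangleright>< \<BB>\<close> for a left \<open>H\<close>-module algebra \<open>A\<close> with action \<open>l\<close>; the formula is that of \<open>\<A> # \<BB>\<close>, but the result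
  is regarded as an algebra without \<open>H\<close>-action.
\<close>

definition left_crossed_product ::
  "'k ring \<Rightarrow> ('k, 'h) module \<Rightarrow> ('k, 'a) module \<Rightarrow> ('h \<Rightarrow> 'a \<Rightarrow> 'a) \<Rightarrow>
   ('k, 'b) module \<Rightarrow> ('b \<Rightarrow> ('h, 'b) tensor) \<Rightarrow> (('h, 'h) tensor, 'b) tensor \<Rightarrow>
   ('k, ('a, 'b) tensor) module" where
  "left_crossed_product K H A l B \<Lambda> \<Phi>\<^sub>\<Lambda> = (let T = tensor K A B in
    T\<lparr>mult := (\<lambda>s t.
      tsum T s (\<lambda>a b. tsum T t (\<lambda>a' b'.
      tsum T (\<Lambda> b) (\<lambda>b1 b0. tsum3 T (inv\<^bsub>tensor3 K H H B\<^esub> \<Phi>\<^sub>\<Lambda>) (\<lambda>x1 x2 x3.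
        tens K A B
          (l x1 a \<otimes>\<^bsub>A\<^esub> l (x2 \<otimes>\<^bsub>H\<^esub> b1) a')
          (x3 \<otimes>\<^bsub>B\<^esub> b0 \<otimes>\<^bsub>B\<^esub> b'))))))\<rparr>)"

text \<open>\<open>\<AA> >\<blacktriangleleft> B\<close> for a right \<open>H\<close>-module algebra \<open>B\<close> with action \<open>r\<close>\<close>

definition right_crossed_product ::
  "'k ring \<Rightarrow> ('k, 'h) module \<Rightarrow> ('k, 'a) module \<Rightarrow> ('a \<Rightarrow> ('a, 'h) tensor) \<Rightarrow>
   (('a, 'h) tensor, 'h) tensor \<Rightarrow> ('k, 'b) module \<Rightarrow> ('b \<Rightarrow> 'h \<Rightarrow> 'b) \<Rightarrow> ('k, ('a, 'b) tensor) module" where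
  "right_crossed_product K H A \<rho> \<Phi>\<^sub>\<rho> B r = (let T = tensor K A B in
    T\<lparr>mult := (\<lambda>s t.
      tsum T s (\<lambda>a b. tsum T t (\<lambda>a' b'.
      tsum T (\<rho> a') (\<lambda>a0 a1. tsum3 T (inv\<^bsub>tensor3 K A H H\<^esub> \<Phi>\<^sub>\<rho>) (\<lambda>y1 y2 y3.
        tens K A B
          (a \<otimes>\<^bsub>A\<^esub> a0 \<otimes>\<^bsub>A\<^esub> y1)
          (r b (a1 \<otimes>\<^bsub>H\<^esub> y2) \<otimes>\<^bsub>B\<^esub> r b' y3))))))\<rparr>)"

text \<open>\<open>\<AA> >\<triangleleft> \<A> \<triangleright>< \<BB>\<close>\<close>

definition two_sided_crossed_product ::
  "'k ring \<Rightarrow> ('k, 'h) module \<Rightarrow>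
   ('k, 'a) module \<Rightarrow> ('a \<Rightarrow> ('a, 'h) tensor) \<Rightarrow> (('a, 'h) tensor, 'h) tensor \<Rightarrow>
   ('k, 'm) module \<Rightarrow> ('h \<Rightarrow> 'm \<Rightarrow> 'm) \<Rightarrow> ('m \<Rightarrow> 'h \<Rightarrow> 'm) \<Rightarrow>
   ('k, 'b) module \<Rightarrow> ('b \<Rightarrow> ('h, 'b) tensor) \<Rightarrow> (('h, 'h) tensor, 'b) tensor \<Rightarrow>
   ('k, (('a, 'm) tensor, 'b) tensor) module" where
  "two_sided_crossed_product K H A \<rho> \<Phi>\<^sub>\<rho> M l r B \<Lambda> \<Phi>\<^sub>\<Lambda> = (let T = tensor3 K A M B in
    T\<lparr>mult := (\<lambda>s t.
      tsum3 T s (\<lambda>a m b. tsum3 T t (\<lambda>a' m' b'.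
      tsum T (\<rho> a') (\<lambda>a0 a1. tsum T (\<Lambda> b) (\<lambda>b1 b0.
      tsum3 T (inv\<^bsub>tensor3 K A H H\<^esub> \<Phi>\<^sub>\<rho>) (\<lambda>y1 y2 y3.
      tsum3 T (inv\<^bsub>tensor3 K H H B\<^esub> \<Phi>\<^sub>\<Lambda>) (\<lambda>x1 x2 x3.
        tens3 K A M B
          (a \<otimes>\<^bsub>A\<^esub> a0 \<otimes>\<^bsub>A\<^esub> y1)
          (r (l x1 m) (a1 \<otimes>\<^bsub>H\<^esub> y2) \<otimes>\<^bsub>M\<^esub> r (l (x2 \<otimes>\<^bsub>H\<^esub> b1) m') y3)
          (x3 \<otimes>\<^bsub>B\<^esub> b0 \<otimes>\<^bsub>B\<^esub> b'))))))))\<rparr>)"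

end

theory Submission
  imports Defs
begin

text \<open>
  All products involved are bilinear, so it suffices to compare them on pure tensors.  There, unfolding
  the inner quasi-smash product inside the outer crossed product gives the sum defining the two-sided
  product, up to moving linear maps through sums, exchanging independent sums and, for the second
  isomorphism, commuting the left and right actions of the bimodule.
\<close>

text \<open>The two-sided product lives on the left-bracketed tensor product, which is also the
  carrier of the first crossed product. Hence the first isomorphism is the identity, while the
  second is the rebracketing \<open>assoc_right\<close>.

  Three features of the encoding shape the proof. A Sweedler sum \<open>tsum\<close> folds over an
  arbitrary representative: exchanging such sums or pushing a linear map through them is list
  induction, but evaluating one at a pure tensor requires a bilinear summand, so the multiplications
  of the crossed products must first be shown bilinear. The inverse reassociators are fixed tensors
  to sum over, and they must be known to lie in the carrier. The inner quasi-smash product is a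
  tensor product record with its multiplication overwritten, and the outer tensor product has to be
  recognised as the plain iterated one.

  A quasi-smash multiplication has the same formula as a crossed product, so one lemma per side,
  stated for an arbitrary coefficient algebra, serves both the inner and the outer layer.\<close>

section \<open>Linear and bilinear maps\<close>

lemma linear_mapD:
  assumes "linear_map K V W f"
  shows "v \<in> carrier V \<Longrightarrow> f v \<in> carrier W"
    and "v \<in> carrier V \<Longrightarrow> v' \<in> carrier V \<Longrightarrow> f (v \<oplus>\<^bsub>V\<^esub> v') = f v \<oplus>\<^bsub>W\<^esub> f v'"
    and "c \<in> carrier K \<Longrightarrow> v \<in> carrier V \<Longrightarrow> f (c \<odot>\<^bsub>V\<^esub> v) = c \<odot>\<^bsub>W\<^esub> f v"
  using assms by (auto simp: linear_map_def)

lemma linear_mapI: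
  assumes "\<And>v. v \<in> carrier V \<Longrightarrow> f v \<in> carrier W"
    and "\<And>v v'. v \<in> carrier V \<Longrightarrow> v' \<in> carrier V \<Longrightarrow> f (v \<oplus>\<^bsub>V\<^esub> v') = f v \<oplus>\<^bsub>W\<^esub> f v'"
    and "\<And>c v. c \<in> carrier K \<Longrightarrow> v \<in> carrier V \<Longrightarrow> f (c \<odot>\<^bsub>V\<^esub> v) = c \<odot>\<^bsub>W\<^esub> f v"
  shows "linear_map K V W f"
  using assms by (auto simp: linear_map_def)

lemma linear_map_zero:
  assumes "module K V" "module K W" "linear_map K V W f"
  shows "f \<zero>\<^bsub>V\<^esub> = \<zero>\<^bsub>W\<^esub>"
proof -
  interpret V: module K V by fact
  interpret W: module K W by fact
  have "f (\<zero>\<^bsub>K\<^esub> \<odot>\<^bsub>V\<^esub> \<zero>\<^bsub>V\<^esub>) = \<zero>\<^bsub>K\<^esub> \<odot>\<^bsub>W\<^esub> f \<zero>\<^bsub>V\<^esub>"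
    by (rule linear_mapD(3)[OF assms(3)]) auto
  then show ?thesis using linear_mapD(1)[OF assms(3), of "\<zero>\<^bsub>V\<^esub>"] by simp
qed

lemma linear_map_ident: "linear_map K V V (\<lambda>x. x)"
  by (simp add: linear_map_def)

lemma linear_map_comp:
  assumes "linear_map K W U g" "linear_map K V W f"
  shows "linear_map K V U (\<lambda>x. g (f x))"
  using assms by (auto simp: linear_map_def Pi_iff)

lemma bilinear_mapD:
  assumes "bilinear_map K V W U f"
  shows "w \<in> carrier W \<Longrightarrow> linear_map K V U (\<lambda>v. f v w)"
    and "v \<in> carrier V \<Longrightarrow> linear_map K W U (f v)"
  using assms by (auto simp: bilinear_map_def)

lemma bilinear_map_closed:
  assumes "bilinear_map K V W U f" "v \<in> carrier V" "w \<in> carrier W"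
  shows "f v w \<in> carrier U"
  using bilinear_mapD(2)[OF assms(1,2)] assms(3) by (rule linear_mapD(1))

text \<open>With \<open>linear_map_ident\<close>, this rule and the next form a backward calculus:
  repeated resolution follows the path to the single occurrence of a variable in a nested product
  and proves linearity in it.\<close>

lemma bilinear_map_comp_left:
  assumes "bilinear_map K V W U f" "linear_map K X V g" "w \<in> carrier W"
  shows "linear_map K X U (\<lambda>x. f (g x) w)"
  using linear_map_comp[OF bilinear_mapD(1)[OF assms(1,3)] assms(2)] .

lemma bilinear_map_comp_right:
  assumes "bilinear_map K V W U f" "linear_map K X W g" "v \<in> carrier V"
  shows "linear_map K X U (\<lambda>x. f v (g x))"
  using linear_map_comp[OF bilinear_mapD(2)[OF assms(1,3)] assms(2)] .

lemma bilinear_mapI: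
  assumes "\<And>w. w \<in> carrier W \<Longrightarrow> linear_map K V U (\<lambda>v. f v w)"
    and "\<And>v. v \<in> carrier V \<Longrightarrow> linear_map K W U (f v)"
  shows "bilinear_map K V W U f"
  using assms by (auto simp: bilinear_map_def)

section \<open>Sums over representatives of tensors\<close>

text \<open>\<open>rep t\<close> is one fixed list of carrier pairs. This turns statements about
  \<open>tsum U t\<close> into inductions over that list.\<close>

lemma rep_formal_sums:
  assumes "module K V" "module K W" "t \<in> carrier (tensor K V W)"
  shows "rep t \<in> formal_sums V W" and "tensor_class K V W (rep t) = t"
proof -
  obtain xs where xs: "xs \<in> formal_sums V W" "t = tensor_class K V W xs"
    using assms(3) by (auto simp: tensor_def)
  have e: "tensor_eq K V W xs (rep t)" using rep_class[OF assms(1,2) xs(1)] xs(2) by simp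
  then show "rep t \<in> formal_sums V W" using tensor_eq_formal_sums[OF assms(1,2)] by blast
  show "tensor_class K V W (rep t) = t"
    using tensor_class_eq_iff[OF assms(1,2) xs(1), of "rep t"] e xs(2) by metis
qed

lemma tens_closed:
  assumes "module K V" "module K W" "v \<in> carrier V" "w \<in> carrier W"
  shows "tens K V W v w \<in> carrier (tensor K V W)"
  by (rule bilinear_map_closed[OF tens_bilinear[OF assms(1,2)] assms(3,4)])

lemma tensor_class_add:
  assumes "module K V" "module K W" "xs \<in> formal_sums V W" "ys \<in> formal_sums V W"
  shows "tensor_class K V W xs \<oplus>\<^bsub>tensor K V W\<^esub> tensor_class K V W ys = tensor_class K V W (xs @ ys)"
proof -
  have "xs @ ys \<in> formal_sums V W" using assms by (simp add: formal_sums_def)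
  from tensor_class_eq_iff[OF assms(1,2) this, THEN iffD2,
      OF tensor_eq.append[OF rep_class[OF assms(1,2,3)] rep_class[OF assms(1,2,4)]]]
  show ?thesis by (simp add: tensor_def)
qed

lemma fsum_Nil: "fsum U f [] = \<zero>\<^bsub>U\<^esub>"
  and fsum_Cons: "fsum U f ((v, w) # xs) = f v w \<oplus>\<^bsub>U\<^esub> fsum U f xs"
  by (simp_all add: fsum_def)

lemma formal_sums_Nil: "[] \<in> formal_sums V W"
  and formal_sums_Cons:
    "(v, w) # xs \<in> formal_sums V W \<longleftrightarrow> v \<in> carrier V \<and> w \<in> carrier W \<and> xs \<in> formal_sums V W"
  by (auto simp: formal_sums_def)

lemma formal_sums_induct [consumes 1, case_names Nil Cons]:
  assumes "xs \<in> formal_sums V W" "P []"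
    and "\<And>v w xs. v \<in> carrier V \<Longrightarrow> w \<in> carrier W \<Longrightarrow> xs \<in> formal_sums V W \<Longrightarrow> P xs \<Longrightarrow> P ((v, w) # xs)"
  shows "P xs"
  using assms(1)
proof (induct xs)
  case Nil show ?case by (rule assms(2))
next
  case (Cons p xs)
  then show ?case using assms(3) by (cases p) (auto simp: formal_sums_Cons)
qed

lemma tensor_class_fsum:
  assumes "module K V" "module K W" "xs \<in> formal_sums V W"
  shows "tensor_class K V W xs = fsum (tensor K V W) (tens K V W) xs"
  using assms(3)
proof (induct rule: formal_sums_induct)
  case Nil show ?case by (simp add: fsum_Nil tensor_def)
next
  case (Cons v w xs)
  have "[(v, w)] \<in> formal_sums V W" using Cons by (simp add: formal_sums_def)
  from tensor_class_add[OF assms(1,2) this Cons(3)] Cons(4)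
  show ?case by (simp add: fsum_Cons tens_def)
qed

text \<open>Every tensor is the sum of the pure tensors listed in its representative. This is the
  source of all reductions to pure tensors below.\<close>

lemma tsum_tens_self:
  assumes "module K V" "module K W" "t \<in> carrier (tensor K V W)"
  shows "tsum (tensor K V W) t (tens K V W) = t"
  using tensor_class_fsum[OF assms(1,2) rep_formal_sums(1)[OF assms]] rep_formal_sums(2)[OF assms]
  by (simp add: tsum_fsum)

text \<open>Both sides fold over the same list \<open>rep t\<close>, so agreement on carrier pairs
  suffices. Bilinearity matters only where a sum must be independent of the representative.\<close>

lemma tsum_cong:
  assumes "module K V" "module K W" "t \<in> carrier (tensor K V W)"
    and "\<And>v w. v \<in> carrier V \<Longrightarrow> w \<in> carrier W \<Longrightarrow> f v w = g v w"
  shows "tsum U t f = tsum U t g"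
  unfolding tsum_fsum using rep_formal_sums(1)[OF assms(1-3)]
  by (induct rule: formal_sums_induct) (simp_all add: fsum_Nil fsum_Cons assms(4))

lemma fsum_closedI:
  assumes "module K U" "xs \<in> formal_sums V W"
    and "\<And>v w. v \<in> carrier V \<Longrightarrow> w \<in> carrier W \<Longrightarrow> f v w \<in> carrier U"
  shows "fsum U f xs \<in> carrier U"
proof -
  interpret U: module K U by fact
  show ?thesis using assms(2)
    by (induct rule: formal_sums_induct) (simp_all add: fsum_Nil fsum_Cons assms(3))
qed

lemma tsum_closed:
  assumes "module K V" "module K W" "module K U" "t \<in> carrier (tensor K V W)"
    and "\<And>v w. v \<in> carrier V \<Longrightarrow> w \<in> carrier W \<Longrightarrow> f v w \<in> carrier U"
  shows "tsum U t f \<in> carrier U"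
  unfolding tsum_fsum by (rule fsum_closedI[OF assms(3) rep_formal_sums(1)[OF assms(1,2,4)] assms(5)])

lemma linear_map_tsum:
  assumes "module K V" "module K W" "module K U" "module K U'" "t \<in> carrier (tensor K V W)"
    and "linear_map K U U' g"
    and "\<And>v w. v \<in> carrier V \<Longrightarrow> w \<in> carrier W \<Longrightarrow> f v w \<in> carrier U"
  shows "g (tsum U t f) = tsum U' t (\<lambda>v w. g (f v w))"
  unfolding tsum_fsum using rep_formal_sums(1)[OF assms(1,2,5)]
proof (induct rule: formal_sums_induct)
  case Nil show ?case by (simp add: fsum_Nil linear_map_zero[OF assms(3,4,6)])
next
  case (Cons v w xs)
  then show ?case
    by (simp add: fsum_Cons linear_mapD(2)[OF assms(6)] assms(7) fsum_closedI[OF assms(3) Cons(3)])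
qed

text \<open>A variable can enter a Sweedler sum in two ways: in the summand, treated here, or in the
  tensor that is summed over, treated in \<open>tsum_arg_linear\<close>. The second way occurs for
  the arguments of the coactions.\<close>

lemma tsum_body_linear:
  assumes "module K V" "module K W" "module K U" "t \<in> carrier (tensor K V W)"
    and "\<And>v w. v \<in> carrier V \<Longrightarrow> w \<in> carrier W \<Longrightarrow> linear_map K X U (\<lambda>x. f x v w)"
  shows "linear_map K X U (\<lambda>x. tsum U t (f x))"
proof -
  interpret U: module K U by fact
  have cl: "x \<in> carrier X \<Longrightarrow> xs \<in> formal_sums V W \<Longrightarrow> fsum U (f x) xs \<in> carrier U" for x xs
    by (rule fsum_closedI[OF assms(3)]) (auto intro: linear_mapD(1)[OF assms(5)])
  have "linear_map K X U (\<lambda>x. fsum U (f x) (rep t))"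
    using rep_formal_sums(1)[OF assms(1,2,4)]
  proof (induct rule: formal_sums_induct)
    case Nil show ?case by (rule linear_mapI) (simp_all add: fsum_Nil)
  next
    case (Cons v w xs)
    note l = linear_mapD[OF assms(5)[OF Cons(1,2)]] and IH = linear_mapD[OF Cons(4)]
    show ?case
      by (rule linear_mapI) (simp_all add: fsum_Cons l IH U.smult_r_distr U.a_ac)
  qed
  then show ?thesis by (simp add: tsum_fsum)
qed

lemma tsum_arg_linear:
  assumes "module K V" "module K W" "module K U" "bilinear_map K V W U f"
    and "linear_map K X (tensor K V W) g"
  shows "linear_map K X U (\<lambda>x. tsum U (g x) f)"
  by (rule linear_map_comp[OF tsum_linear[OF assms(1-4)] assms(5)])

text \<open>A linear \<open>h\<close> satisfies
  \<open>h t = tsum U t (\<lambda>v w. h (tens K V W v w))\<close>, by pushing \<open>h\<close>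
  through the expansion of \<open>t\<close> into pure tensors; the right-hand side sees only values
  at pure tensors.\<close>

lemma linear_map_eq_on_tens:
  assumes "module K V" "module K W" "module K U"
    and "linear_map K (tensor K V W) U f" "linear_map K (tensor K V W) U g"
    and "\<And>v w. v \<in> carrier V \<Longrightarrow> w \<in> carrier W \<Longrightarrow> f (tens K V W v w) = g (tens K V W v w)"
    and t: "t \<in> carrier (tensor K V W)"
  shows "f t = g t"
proof -
  have *: "h t = tsum U t (\<lambda>v w. h (tens K V W v w))" if "linear_map K (tensor K V W) U h" for h
    using linear_map_tsum[OF assms(1,2) tensor_module[OF assms(1,2)] assms(3) t that,
        of "tens K V W"] tsum_tens_self[OF assms(1,2) t] tens_closed[OF assms(1,2)] by simp
  show ?thesis
    unfolding *[OF assms(4)] *[OF assms(5)] by (rule tsum_cong[OF assms(1,2) t assms(6)])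
qed

text \<open>A finite double sum over two independent lists. Induction on the list of
  \<open>s\<close>: each new entry contributes one more sum over \<open>t\<close>, which
  \<open>a\<close> merges with the sum of the remaining entries.\<close>

lemma tsum_swap:
  assumes "module K V" "module K W" "module K V'" "module K W'" "module K U"
    and s: "s \<in> carrier (tensor K V W)" and t: "t \<in> carrier (tensor K V' W')"
    and cl: "\<And>v w v' w'. v \<in> carrier V \<Longrightarrow> w \<in> carrier W \<Longrightarrow> v' \<in> carrier V' \<Longrightarrow> w' \<in> carrier W' \<Longrightarrow>
      f v w v' w' \<in> carrier U"
  shows "tsum U s (\<lambda>v w. tsum U t (\<lambda>v' w'. f v w v' w'))
    = tsum U t (\<lambda>v' w'. tsum U s (\<lambda>v w. f v w v' w'))"
proof -
  interpret U: module K U by fact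
  have z: "fsum U (\<lambda>v w. \<zero>\<^bsub>U\<^esub>) xs = \<zero>\<^bsub>U\<^esub>" if "xs \<in> formal_sums V' W'" for xs
    using that by (induct rule: formal_sums_induct) (simp_all add: fsum_Nil fsum_Cons)
  have a: "fsum U (\<lambda>v w. g v w \<oplus>\<^bsub>U\<^esub> h v w) xs = fsum U g xs \<oplus>\<^bsub>U\<^esub> fsum U h xs"
    if "xs \<in> formal_sums V' W'" and gh: "\<And>v w. v \<in> carrier V' \<Longrightarrow> w \<in> carrier W' \<Longrightarrow> g v w \<in> carrier U"
      "\<And>v w. v \<in> carrier V' \<Longrightarrow> w \<in> carrier W' \<Longrightarrow> h v w \<in> carrier U" for g h xs
    using that(1)
  proof (induct rule: formal_sums_induct)
    case Nil show ?case by (simp add: fsum_Nil)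
  next
    case (Cons v w xs)
    then show ?case
      using fsum_closedI[OF assms(5) Cons(3) gh(1)] fsum_closedI[OF assms(5) Cons(3) gh(2)]
      by (simp add: fsum_Cons gh U.a_ac)
  qed
  note t' = rep_formal_sums(1)[OF assms(3,4) t]
  show ?thesis
    unfolding tsum_fsum using rep_formal_sums(1)[OF assms(1,2) s]
  proof (induct rule: formal_sums_induct)
    case Nil show ?case by (simp add: fsum_Nil z[OF t'])
  next
    case (Cons v w xs)
    show ?case
      unfolding fsum_Cons Cons(4)
      by (rule a[OF t', symmetric]) (use Cons cl in \<open>auto intro: fsum_closedI[OF assms(5)]\<close>)
  qed
qed

text \<open>The common shape of the multiplications on twofold tensor products: a fourfold linear
  expression summed over both factors. It yields the two facts needed about each of them,
  bilinearity and the value on pure tensors.\<close>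

lemma tsum_tsum_bilinear:
  assumes m: "module K V" "module K W" "module K V'" "module K W'" "module K U"
    and 1: "\<And>w v' w'. w \<in> carrier W \<Longrightarrow> v' \<in> carrier V' \<Longrightarrow> w' \<in> carrier W' \<Longrightarrow>
      linear_map K V U (\<lambda>v. f v w v' w')"
    and 2: "\<And>v v' w'. v \<in> carrier V \<Longrightarrow> v' \<in> carrier V' \<Longrightarrow> w' \<in> carrier W' \<Longrightarrow>
      linear_map K W U (\<lambda>w. f v w v' w')"
    and 3: "\<And>v w w'. v \<in> carrier V \<Longrightarrow> w \<in> carrier W \<Longrightarrow> w' \<in> carrier W' \<Longrightarrow>
      linear_map K V' U (\<lambda>v'. f v w v' w')"
    and 4: "\<And>v w v'. v \<in> carrier V \<Longrightarrow> w \<in> carrier W \<Longrightarrow> v' \<in> carrier V' \<Longrightarrow>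
      linear_map K W' U (\<lambda>w'. f v w v' w')"
  defines "F \<equiv> \<lambda>s t. tsum U s (\<lambda>v w. tsum U t (\<lambda>v' w'. f v w v' w'))"
  shows "bilinear_map K (tensor K V W) (tensor K V' W') U F" (is ?bil)
    and "v \<in> carrier V \<Longrightarrow> w \<in> carrier W \<Longrightarrow> v' \<in> carrier V' \<Longrightarrow> w' \<in> carrier W' \<Longrightarrow>
      F (tens K V W v w) (tens K V' W' v' w') = f v w v' w'" (is "PROP ?val")
proof -
  have inner: "bilinear_map K V' W' U (f v w)" if "v \<in> carrier V" "w \<in> carrier W" for v w
    using that by (intro bilinear_mapI 3 4)
  have outer: "bilinear_map K V W U (\<lambda>v w. tsum U t (f v w))" if "t \<in> carrier (tensor K V' W')" for t
    using that by (intro bilinear_mapI tsum_body_linear[OF m(3-5)] 1 2)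
  show ?bil unfolding F_def
    by (intro bilinear_mapI tsum_linear[OF m(1,2,5)] outer
        tsum_body_linear[OF m(1,2,5)] tsum_linear[OF m(3-5)] inner)
  show "PROP ?val" unfolding F_def
    by (simp add: tsum_tens[OF m(1,2,5) outer] tsum_tens[OF m(3-5) inner] tens_closed m)
qed


section \<open>Sums over threefold tensors\<close>

lemma tsum3_cong:
  assumes "module K V" "module K W" "module K X" "t \<in> carrier (tensor3 K V W X)"
    and "\<And>v w x. v \<in> carrier V \<Longrightarrow> w \<in> carrier W \<Longrightarrow> x \<in> carrier X \<Longrightarrow> f v w x = g v w x"
  shows "tsum3 U t f = tsum3 U t g"
  unfolding tsum3_def
  by (intro tsum_cong[OF tensor_module[OF assms(1,2)] assms(3,4)] tsum_cong[OF assms(1,2)] assms(5))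

lemma tsum3_closed:
  assumes "module K V" "module K W" "module K X" "module K U" "t \<in> carrier (tensor3 K V W X)"
    and "\<And>v w x. v \<in> carrier V \<Longrightarrow> w \<in> carrier W \<Longrightarrow> x \<in> carrier X \<Longrightarrow> f v w x \<in> carrier U"
  shows "tsum3 U t f \<in> carrier U"
  unfolding tsum3_def
  by (intro tsum_closed[OF tensor_module[OF assms(1,2)] assms(3-5)] tsum_closed[OF assms(1,2,4)] assms(6))

lemma linear_map_tsum3:
  assumes "module K V" "module K W" "module K X" "module K U" "module K U'"
    and t: "t \<in> carrier (tensor3 K V W X)" and g: "linear_map K U U' g"
    and f: "\<And>v w x. v \<in> carrier V \<Longrightarrow> w \<in> carrier W \<Longrightarrow> x \<in> carrier X \<Longrightarrow> f v w x \<in> carrier U"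
  shows "g (tsum3 U t f) = tsum3 U' t (\<lambda>v w x. g (f v w x))"
proof -
  have "g (tsum3 U t f) = tsum U' t (\<lambda>s x. g (tsum U s (\<lambda>v w. f v w x)))"
    unfolding tsum3_def
    by (rule linear_map_tsum[OF tensor_module[OF assms(1,2)] assms(3-5) t g])
      (rule tsum_closed[OF assms(1,2,4)], auto intro: f)
  also have "\<dots> = tsum3 U' t (\<lambda>v w x. g (f v w x))"
    unfolding tsum3_def
    by (rule tsum_cong[OF tensor_module[OF assms(1,2)] assms(3) t],
        rule linear_map_tsum[OF assms(1,2,4,5) _ g]) (auto intro: f)
  finally show ?thesis .
qed

lemma tsum3_body_linear:
  assumes "module K V" "module K W" "module K X" "module K U" "t \<in> carrier (tensor3 K V W X)"
    and "\<And>v w x. v \<in> carrier V \<Longrightarrow> w \<in> carrier W \<Longrightarrow> x \<in> carrier X \<Longrightarrow>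
      linear_map K Y U (\<lambda>y. f y v w x)"
  shows "linear_map K Y U (\<lambda>y. tsum3 U t (f y))"
  unfolding tsum3_def
  by (intro tsum_body_linear[OF tensor_module[OF assms(1,2)] assms(3-5)]
      tsum_body_linear[OF assms(1,2,4)] assms(6))

lemma tsum3_tsum_swap:
  assumes "module K V" "module K W" "module K X" "module K V'" "module K W'" "module K U"
    and s: "s \<in> carrier (tensor3 K V W X)" and t: "t \<in> carrier (tensor K V' W')"
    and cl: "\<And>v w x v' w'. v \<in> carrier V \<Longrightarrow> w \<in> carrier W \<Longrightarrow> x \<in> carrier X \<Longrightarrow>
      v' \<in> carrier V' \<Longrightarrow> w' \<in> carrier W' \<Longrightarrow> f v w x v' w' \<in> carrier U"
  shows "tsum3 U s (\<lambda>v w x. tsum U t (\<lambda>v' w'. f v w x v' w'))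
    = tsum U t (\<lambda>v' w'. tsum3 U s (\<lambda>v w x. f v w x v' w'))"
proof -
  note m = tensor_module[OF assms(1,2)]
  have "tsum3 U s (\<lambda>v w x. tsum U t (\<lambda>v' w'. f v w x v' w'))
    = tsum U s (\<lambda>u x. tsum U t (\<lambda>v' w'. tsum U u (\<lambda>v w. f v w x v' w')))"
    unfolding tsum3_def
    by (rule tsum_cong[OF m assms(3) s], rule tsum_swap[OF assms(1,2,4,5,6) _ t]) (auto intro: cl)
  also have "\<dots> = tsum U t (\<lambda>v' w'. tsum3 U s (\<lambda>v w x. f v w x v' w'))"
    unfolding tsum3_def
    by (rule tsum_swap[OF m assms(3-6) s t], rule tsum_closed[OF assms(1,2,6)]) (auto intro: cl)
  finally show ?thesis .
qed

lemma tsum3_swap: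
  assumes "module K V" "module K W" "module K X" "module K V'" "module K W'" "module K X'" "module K U"
    and s: "s \<in> carrier (tensor3 K V W X)" and t: "t \<in> carrier (tensor3 K V' W' X')"
    and cl: "\<And>v w x v' w' x'. v \<in> carrier V \<Longrightarrow> w \<in> carrier W \<Longrightarrow> x \<in> carrier X \<Longrightarrow>
      v' \<in> carrier V' \<Longrightarrow> w' \<in> carrier W' \<Longrightarrow> x' \<in> carrier X' \<Longrightarrow> f v w x v' w' x' \<in> carrier U"
  shows "tsum3 U s (\<lambda>v w x. tsum3 U t (\<lambda>v' w' x'. f v w x v' w' x'))
    = tsum3 U t (\<lambda>v' w' x'. tsum3 U s (\<lambda>v w x. f v w x v' w' x'))"
proof -
  note m = tensor_module[OF assms(4,5)]
  have "tsum3 U s (\<lambda>v w x. tsum3 U t (\<lambda>v' w' x'. f v w x v' w' x'))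
    = tsum U t (\<lambda>u x'. tsum3 U s (\<lambda>v w x. tsum U u (\<lambda>v' w'. f v w x v' w' x')))"
    \<comment> \<open>Only the triple sum over \<open>t\<close> is split into its two layers; the
      triple sum over \<open>s\<close> is then moved past one layer at a time.\<close>
    unfolding tsum3_def[of U t]
    by (rule tsum3_tsum_swap[OF assms(1-3) m assms(6,7) s t], rule tsum_closed[OF assms(4,5,7)])
      (auto intro: cl)
  also have "\<dots> = tsum3 U t (\<lambda>v' w' x'. tsum3 U s (\<lambda>v w x. f v w x v' w' x'))"
    unfolding tsum3_def[of U t]
    by (rule tsum_cong[OF m assms(6) t], rule tsum3_tsum_swap[OF assms(1-5,7) s]) (auto intro: cl)
  finally show ?thesis .
qed

lemma linear_map_tsum3_tens3:
  assumes "module K V" "module K W" "module K X" "module K U"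
    and "linear_map K (tensor3 K V W X) U f" "t \<in> carrier (tensor3 K V W X)"
  shows "f t = tsum3 U t (\<lambda>v w x. f (tens3 K V W X v w x))"
proof -
  note m = tensor_module[OF assms(1,2)]
  note m3 = tensor_module[OF m assms(3)]
  have "f t = f (tsum3 (tensor3 K V W X) t (tens3 K V W X))"
  proof -
    have "tsum3 (tensor3 K V W X) t (tens3 K V W X)
      = tsum (tensor3 K V W X) t (tens K (tensor K V W) X)"
      unfolding tsum3_def
    proof (rule tsum_cong[OF m assms(3,6)])
      fix s x assume "s \<in> carrier (tensor K V W)" "x \<in> carrier X"
      then show "tsum (tensor3 K V W X) s (\<lambda>v w. tens3 K V W X v w x) = tens K (tensor K V W) X s x"
        using linear_map_tsum[OF assms(1,2) m m3 _ bilinear_mapD(1)[OF tens_bilinear[OF m assms(3)]]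
            tens_closed[OF assms(1,2)], of s x "\<lambda>v w. v" "\<lambda>v w. w"]
          tsum_tens_self[OF assms(1,2)] by simp
    qed
    then show ?thesis using tsum_tens_self[OF m assms(3,6)] by simp
  qed
  also have "\<dots> = tsum3 U t (\<lambda>v w x. f (tens3 K V W X v w x))"
    by (rule linear_map_tsum3[OF assms(1-3) m3 assms(4,6,5)]) (simp add: tens_closed m assms)
  finally show ?thesis .
qed

text \<open>Brings a bilinear product to the form in which the two-sided crossed product is defined,
  a triple sum inside a triple sum, so that the two can be compared summand by summand.\<close>

lemma bilinear_map_tsum3_tens3:
  assumes m: "module K V" "module K W" "module K X" "module K V'" "module K W'" "module K X'" "module K U"
    and f: "bilinear_map K (tensor3 K V W X) (tensor3 K V' W' X') U f"
    and s: "s \<in> carrier (tensor3 K V W X)" and t: "t \<in> carrier (tensor3 K V' W' X')"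
  shows "f s t = tsum3 U s (\<lambda>v w x. tsum3 U t (\<lambda>v' w' x'.
    f (tens3 K V W X v w x) (tens3 K V' W' X' v' w' x')))"
proof -
  have "f s t = tsum3 U s (\<lambda>v w x. f (tens3 K V W X v w x) t)"
    by (rule linear_map_tsum3_tens3[OF m(1-3,7) bilinear_mapD(1)[OF f t] s])
  also have "\<dots> = tsum3 U s (\<lambda>v w x. tsum3 U t (\<lambda>v' w' x'.
    f (tens3 K V W X v w x) (tens3 K V' W' X' v' w' x')))"
    by (rule tsum3_cong[OF m(1-3) s], rule linear_map_tsum3_tens3[OF m(4-7) bilinear_mapD(2)[OF f] t])
      (simp add: tens_closed tensor_module m)
  finally show ?thesis .
qed

section \<open>The tensor product of algebras\<close>

text \<open>The multiplication of \<open>tensor\<close> concatenates lists of products, while the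
  calculus above works with sums. The induction runs row by row, \<open>p v w\<close> being the row
  of one entry of \<open>xs\<close>. Membership in \<open>formal_sums\<close> is carried along
  because \<open>tensor_class_add\<close> demands it.\<close>

lemma tensor_mult_class:
  assumes m: "module K V" "module K W"
    and V: "bilinear_map K V V V (mult V)" and W: "bilinear_map K W W W (mult W)"
    and "xs \<in> formal_sums V W" and ys: "ys \<in> formal_sums V W"
  defines "p \<equiv> \<lambda>v w. [(v \<otimes>\<^bsub>V\<^esub> v', w \<otimes>\<^bsub>W\<^esub> w'). (v', w') \<leftarrow> ys]"
  shows "[(v \<otimes>\<^bsub>V\<^esub> v', w \<otimes>\<^bsub>W\<^esub> w'). (v, w) \<leftarrow> xs, (v', w') \<leftarrow> ys] \<in> formal_sums V W
    \<and> tensor_class K V W [(v \<otimes>\<^bsub>V\<^esub> v', w \<otimes>\<^bsub>W\<^esub> w'). (v, w) \<leftarrow> xs, (v', w') \<leftarrow> ys]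
      = fsum (tensor K V W) (\<lambda>v w. fsum (tensor K V W)
          (\<lambda>v' w'. tens K V W (v \<otimes>\<^bsub>V\<^esub> v') (w \<otimes>\<^bsub>W\<^esub> w')) ys) xs"
proof -
  have p: "p v w \<in> formal_sums V W \<and> tensor_class K V W (p v w)
      = fsum (tensor K V W) (\<lambda>v' w'. tens K V W (v \<otimes>\<^bsub>V\<^esub> v') (w \<otimes>\<^bsub>W\<^esub> w')) ys"
    if vw: "v \<in> carrier V" "w \<in> carrier W" for v w
    using ys unfolding p_def
  proof (induct rule: formal_sums_induct)
    case Nil show ?case by (simp add: formal_sums_Nil fsum_Nil tensor_def)
  next
    case (Cons v' w' zs)
    have c: "v \<otimes>\<^bsub>V\<^esub> v' \<in> carrier V" "w \<otimes>\<^bsub>W\<^esub> w' \<in> carrier W"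
      using bilinear_map_closed[OF V] bilinear_map_closed[OF W] vw Cons by auto
    then have "[(v \<otimes>\<^bsub>V\<^esub> v', w \<otimes>\<^bsub>W\<^esub> w')] \<in> formal_sums V W" by (simp add: formal_sums_def)
    from tensor_class_add[OF m this Cons(4)[THEN conjunct1]] Cons(4) c
    show ?case by (simp add: fsum_Cons formal_sums_Cons tens_def)
  qed
  show ?thesis using assms(5)
  proof (induct rule: formal_sums_induct)
    case Nil show ?case by (simp add: formal_sums_Nil fsum_Nil tensor_def)
  next
    case (Cons v w xs)
    have app: "as @ bs \<in> formal_sums V W" if "as \<in> formal_sums V W" "bs \<in> formal_sums V W" for as bs
      using that by (simp add: formal_sums_def)
    note pvw = p[OF Cons(1,2)]
    from tensor_class_add[OF m pvw[THEN conjunct1] Cons(4)[THEN conjunct1]] pvw Cons(4)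
      app[OF pvw[THEN conjunct1] Cons(4)[THEN conjunct1]]
    show ?case by (simp add: fsum_Cons p_def)
  qed
qed

lemma tensor_mult:
  assumes m: "module K V" "module K W"
    and V: "bilinear_map K V V V (mult V)" and W: "bilinear_map K W W W (mult W)"
    and s: "s \<in> carrier (tensor K V W)" and t: "t \<in> carrier (tensor K V W)"
  shows "s \<otimes>\<^bsub>tensor K V W\<^esub> t = tsum (tensor K V W) s (\<lambda>v w. tsum (tensor K V W) t (\<lambda>v' w'.
    tens K V W (v \<otimes>\<^bsub>V\<^esub> v') (w \<otimes>\<^bsub>W\<^esub> w')))"
  using tensor_mult_class[OF assms(1-4) rep_formal_sums(1)[OF m s] rep_formal_sums(1)[OF m t]]
  by (simp add: tsum_fsum) (simp add: tensor_def)

text \<open>The \<open>tsum\<close> form of the multiplication is available on the carrier only, so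
  its bilinearity has to be transferred through agreement there.\<close>

lemma bilinear_map_cong:
  assumes "bilinear_map K V W U g" "module K V" "module K W"
    and "\<And>v w. v \<in> carrier V \<Longrightarrow> w \<in> carrier W \<Longrightarrow> f v w = g v w"
  shows "bilinear_map K V W U f"
proof -
  interpret V: module K V by fact
  interpret W: module K W by fact
  note l = linear_mapD[OF bilinear_mapD(1)[OF assms(1)]] and r = linear_mapD[OF bilinear_mapD(2)[OF assms(1)]]
  show ?thesis
    by (intro bilinear_mapI linear_mapI) (simp_all add: assms(4) l r(2,3))
qed

lemma
  assumes m: "module K V" "module K W"
    and V: "bilinear_map K V V V (mult V)" and W: "bilinear_map K W W W (mult W)"
  shows tensor_mult_bilinear:
      "bilinear_map K (tensor K V W) (tensor K V W) (tensor K V W) (mult (tensor K V W))"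
    and tensor_mult_tens:
      "v \<in> carrier V \<Longrightarrow> w \<in> carrier W \<Longrightarrow> v' \<in> carrier V \<Longrightarrow> w' \<in> carrier W \<Longrightarrow>
        tens K V W v w \<otimes>\<^bsub>tensor K V W\<^esub> tens K V W v' w' = tens K V W (v \<otimes>\<^bsub>V\<^esub> v') (w \<otimes>\<^bsub>W\<^esub> w')"
proof -
  note T = tensor_module[OF m] and tens = tens_bilinear[OF m]
  note cl = bilinear_map_closed[OF V] bilinear_map_closed[OF W]
  note b = tsum_tsum_bilinear[OF m m T, where f = "\<lambda>v w v' w'. tens K V W (v \<otimes>\<^bsub>V\<^esub> v') (w \<otimes>\<^bsub>W\<^esub> w')",
      OF bilinear_map_comp_left[OF tens bilinear_mapD(1)[OF V]]
         bilinear_map_comp_right[OF tens bilinear_mapD(1)[OF W]]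
         bilinear_map_comp_left[OF tens bilinear_mapD(2)[OF V]]
         bilinear_map_comp_right[OF tens bilinear_mapD(2)[OF W]]]
  show "bilinear_map K (tensor K V W) (tensor K V W) (tensor K V W) (mult (tensor K V W))"
    by (rule bilinear_map_cong[OF b(1) T T]) (simp_all add: cl tensor_mult[OF assms])
  show "tens K V W v w \<otimes>\<^bsub>tensor K V W\<^esub> tens K V W v' w' = tens K V W (v \<otimes>\<^bsub>V\<^esub> v') (w \<otimes>\<^bsub>W\<^esub> w')"
    if "v \<in> carrier V" "w \<in> carrier W" "v' \<in> carrier V" "w' \<in> carrier W"
    using that by (simp add: cl tensor_mult[OF assms] tens_closed[OF m] b(2))
qed

lemma assoc_algebraD:
  assumes "assoc_algebra K A"
  shows "field K" "module K A" "ring A" "bilinear_map K A A A (mult A)"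
  using assms by (auto simp: assoc_algebra_def)

text \<open>
  Associativity of the tensor product algebra is what makes \<open>inv\<close> of a reassociator (a definite
  description) denote an element of the carrier.
\<close>

lemma tensor_assoc_algebra:
  assumes "assoc_algebra K V" "assoc_algebra K W"
  shows "assoc_algebra K (tensor K V W)"
proof -
  note V = assoc_algebraD[OF assms(1)] and W = assoc_algebraD[OF assms(2)]
  interpret V: ring V by (rule V)
  interpret W: ring W by (rule W)
  let ?T = "tensor K V W"
  note m = V(2) W(2) and T = tensor_module[OF V(2) W(2)]
  interpret T: module K ?T by (rule T)
  note b = tensor_mult_bilinear[OF m V(4) W(4)] and mt = tensor_mult_tens[OF m V(4) W(4)]
  note cl = bilinear_map_closed[OF b] and tc = tens_closed[OF m]
  note eq = linear_map_eq_on_tens[OF m T]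
  have one: "\<one>\<^bsub>?T\<^esub> = tens K V W \<one>\<^bsub>V\<^esub> \<one>\<^bsub>W\<^esub>" by (simp add: tensor_def)
  have one_closed: "\<one>\<^bsub>?T\<^esub> \<in> carrier ?T" unfolding one by (simp add: tc)
  have assoc: "s \<otimes>\<^bsub>?T\<^esub> t \<otimes>\<^bsub>?T\<^esub> u = s \<otimes>\<^bsub>?T\<^esub> (t \<otimes>\<^bsub>?T\<^esub> u)"
    if s: "s \<in> carrier ?T" and t: "t \<in> carrier ?T" and u: "u \<in> carrier ?T" for s t u
  \<comment> \<open>With two factors fixed, both sides are linear in the third. The factors are
    replaced by pure tensors one after the other, and for pure tensors the claim is associativity in
    \<open>V\<close> and in \<open>W\<close>.\<close>
  proof (rule eq[OF bilinear_map_comp_left[OF b bilinear_mapD(1)[OF b t] u]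
        bilinear_mapD(1)[OF b cl[OF t u]] _ s])
    fix v w assume vw: "v \<in> carrier V" "w \<in> carrier W"
    note s' = tc[OF vw]
    show "tens K V W v w \<otimes>\<^bsub>?T\<^esub> t \<otimes>\<^bsub>?T\<^esub> u = tens K V W v w \<otimes>\<^bsub>?T\<^esub> (t \<otimes>\<^bsub>?T\<^esub> u)"
    proof (rule eq[OF bilinear_map_comp_left[OF b bilinear_mapD(2)[OF b s'] u]
          bilinear_map_comp_right[OF b bilinear_mapD(1)[OF b u] s'] _ t])
      fix v' w' assume vw': "v' \<in> carrier V" "w' \<in> carrier W"
      note t' = tc[OF vw']
      show "tens K V W v w \<otimes>\<^bsub>?T\<^esub> tens K V W v' w' \<otimes>\<^bsub>?T\<^esub> u
        = tens K V W v w \<otimes>\<^bsub>?T\<^esub> (tens K V W v' w' \<otimes>\<^bsub>?T\<^esub> u)"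
        by (rule eq[OF bilinear_mapD(2)[OF b cl[OF s' t']]
              bilinear_map_comp_right[OF b bilinear_mapD(2)[OF b t'] s'] _ u])
          (simp add: mt vw vw' V.m_assoc W.m_assoc)
    qed
  qed
  have l_one: "\<one>\<^bsub>?T\<^esub> \<otimes>\<^bsub>?T\<^esub> t = t" if t: "t \<in> carrier ?T" for t
    by (rule eq[OF bilinear_mapD(2)[OF b one_closed] linear_map_ident _ t]) (simp add: one mt)
  have r_one: "t \<otimes>\<^bsub>?T\<^esub> \<one>\<^bsub>?T\<^esub> = t" if t: "t \<in> carrier ?T" for t
    by (rule eq[OF bilinear_mapD(1)[OF b one_closed] linear_map_ident _ t]) (simp add: one mt)
  have "Group.monoid ?T"
    by (rule monoidI) (simp_all add: cl one_closed assoc l_one r_one)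
  then have "ring ?T"
    by (rule ringI[OF T.abelian_group_axioms])
      (simp_all add: linear_mapD(2)[OF bilinear_mapD(1)[OF b]] linear_mapD(2)[OF bilinear_mapD(2)[OF b]])
  then show ?thesis using V(1) T b by (simp add: assoc_algebra_def)
qed


section \<open>Independence of the underlying module from the multiplication\<close>

text \<open>
  A quasi-smash product is a tensor product with its multiplication replaced, which the module
  underlying the outer tensor product does not see.
\<close>

lemma tensor_eq_transfer:
  assumes "tensor_eq K V W xs ys"
    and V: "carrier V' = carrier V" "zero V' = zero V" "add V' = add V" "smult V' = smult V"
    and W: "carrier W' = carrier W" "add W' = add W" "smult W' = smult W"
  shows "tensor_eq K V' W' xs ys"
proof -
  have F: "formal_sums V' W' = formal_sums V W" by (simp add: formal_sums_def V W)
  show ?thesis using assms(1)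
  proof induct
    case refl then show ?case using tensor_eq.refl[of _ V' W' K] by (simp add: F)
  next case sym show ?case by (rule tensor_eq.sym[OF sym(2)])
  next case trans show ?case by (rule tensor_eq.trans[OF trans(2,4)])
  next case append show ?case by (rule tensor_eq.append[OF append(2,4)])
  next case comm then show ?case using tensor_eq.comm[of _ V' W' _ K] by (simp add: F)
  next case zero then show ?case using tensor_eq.zero[of _ W' K V'] by (simp add: V W)
  next case add_left then show ?case using tensor_eq.add_left[of _ V' _ _ W' K] by (simp add: V W)
  next case add_right then show ?case using tensor_eq.add_right[of _ V' _ W' _ K] by (simp add: V W)
  next case balanced then show ?case using tensor_eq.balanced[of _ K _ V' _ W'] by (simp add: V W)
  qed
qed

lemma tensor_eq_mult_update:
  "tensor_eq K (V\<lparr>mult := p\<rparr>) W = tensor_eq K V W"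
  "tensor_eq K V (W\<lparr>mult := q\<rparr>) = tensor_eq K V W"
  by (auto simp: fun_eq_iff elim!: tensor_eq_transfer)

lemma tensor_class_mult_update:
  "tensor_class K (V\<lparr>mult := p\<rparr>) W = tensor_class K V W"
  "tensor_class K V (W\<lparr>mult := q\<rparr>) = tensor_class K V W"
  by (simp_all add: fun_eq_iff tensor_class_def tensor_eq_mult_update)

lemma tens_mult_update:
  "tens K (V\<lparr>mult := p\<rparr>) W = tens K V W"
  "tens K V (W\<lparr>mult := q\<rparr>) = tens K V W"
  by (simp_all add: fun_eq_iff tens_def tensor_class_mult_update)

text \<open>The field \<open>mult\<close> of \<open>tensor K V W\<close> is computed from those of
  \<open>V\<close> and \<open>W\<close>, so the records become equal only once this field is
  overwritten. The crossed products do exactly that.\<close>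

lemma tensor_mult_update:
  "tensor K (V\<lparr>mult := p\<rparr>) W\<lparr>mult := f\<rparr> = tensor K V W\<lparr>mult := f\<rparr>"
  "tensor K V (W\<lparr>mult := q\<rparr>)\<lparr>mult := f\<rparr> = tensor K V W\<lparr>mult := f\<rparr>"
  by (simp_all add: tensor_def tensor_class_mult_update tens_mult_update formal_sums_def)

lemma module_mult_update: "module K (V\<lparr>mult := p\<rparr>) = module K V"
  by (simp add: module_def module_axioms_def abelian_group_def abelian_monoid_def
      abelian_group_axioms_def)

lemma linear_map_mult_update:
  "linear_map K (V\<lparr>mult := p\<rparr>) W = linear_map K V W"
  "linear_map K V (W\<lparr>mult := q\<rparr>) = linear_map K V W"
  by (simp_all add: fun_eq_iff linear_map_def)

lemma bilinear_map_mult_update: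
  "bilinear_map K (V\<lparr>mult := p\<rparr>) W U = bilinear_map K V W U"
  "bilinear_map K V (W\<lparr>mult := q\<rparr>) U = bilinear_map K V W U"
  "bilinear_map K V W (U\<lparr>mult := q'\<rparr>) = bilinear_map K V W U"
  by (simp_all add: fun_eq_iff bilinear_map_def linear_map_mult_update)

lemma tsum_mult_update: "tsum (U\<lparr>mult := p\<rparr>) = tsum U"
  by (simp add: fun_eq_iff tsum_def)

text \<open>The two tensor records may differ in \<open>mult\<close>. Since \<open>tsum\<close>
  ignores that field, both sides may be given the same new multiplication, after which the records
  coincide.\<close>

lemma tsum_tensor_mult_update:
  "tsum (tensor K (V\<lparr>mult := p\<rparr>) W) = tsum (tensor K V W)"
  "tsum (tensor K V (W\<lparr>mult := q\<rparr>)) = tsum (tensor K V W)"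
  by (metis tsum_mult_update tensor_mult_update(1)) (metis tsum_mult_update tensor_mult_update(2))

lemma linear_map_tensor_mult_update:
  "linear_map K (tensor K (V\<lparr>mult := p\<rparr>) W) = linear_map K (tensor K V W)"
  "linear_map K (tensor K V (W\<lparr>mult := q\<rparr>)) = linear_map K (tensor K V W)"
  "linear_map K X (tensor K (V\<lparr>mult := p\<rparr>) W) = linear_map K X (tensor K V W)"
  "linear_map K X (tensor K V (W\<lparr>mult := q\<rparr>)) = linear_map K X (tensor K V W)"
     by (metis (no_types) linear_map_mult_update(1) tensor_mult_update(1) ext)
       (metis (no_types) linear_map_mult_update(1) tensor_mult_update(2) ext,
        metis (no_types) linear_map_mult_update(2) tensor_mult_update(1) ext,
        metis (no_types) linear_map_mult_update(2) tensor_mult_update(2) ext)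

lemma carrier_tensor_mult_update:
  "carrier (tensor K (V\<lparr>mult := p\<rparr>) W) = carrier (tensor K V W)"
  "carrier (tensor K V (W\<lparr>mult := q\<rparr>)) = carrier (tensor K V W)"
  by (simp_all add: tensor_def tensor_class_mult_update formal_sums_def)

lemma bilinear_map_tensor_mult_update:
  "bilinear_map K (tensor K (V\<lparr>mult := p\<rparr>) W) = bilinear_map K (tensor K V W)"
  "bilinear_map K (tensor K V (W\<lparr>mult := q\<rparr>)) = bilinear_map K (tensor K V W)"
  "bilinear_map K X (tensor K (V\<lparr>mult := p\<rparr>) W) = bilinear_map K X (tensor K V W)"
  "bilinear_map K X (tensor K V (W\<lparr>mult := q\<rparr>)) = bilinear_map K X (tensor K V W)"
  "bilinear_map K X Y (tensor K (V\<lparr>mult := p\<rparr>) W) = bilinear_map K X Y (tensor K V W)"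
  "bilinear_map K X Y (tensor K V (W\<lparr>mult := q\<rparr>)) = bilinear_map K X Y (tensor K V W)"
  by (simp_all add: fun_eq_iff bilinear_map_def linear_map_tensor_mult_update carrier_tensor_mult_update)

lemmas mult_update_simps =
  tens_mult_update tensor_mult_update module_mult_update linear_map_mult_update bilinear_map_mult_update
  tsum_mult_update tsum_tensor_mult_update bilinear_map_tensor_mult_update carrier_tensor_mult_update

section \<open>Crossed products on pure tensors\<close>

text \<open>The coefficient module \<open>N\<close> is arbitrary, with a bilinear product and a
  bilinear action, because the lemma is applied twice: with \<open>N\<close> equal to
  \<open>M\<close> it computes the inner quasi-smash product of \<open>A\<close> and
  \<open>M\<close>, and with \<open>N\<close> the quasi-smash product of \<open>M\<close> and
  \<open>B\<close> it computes the outer crossed product.\<close>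

lemma
  assumes m: "module K H" "module K A" "module K N"
    and H: "bilinear_map K H H H (mult H)" and A: "bilinear_map K A A A (mult A)"
    and N: "bilinear_map K N N N (mult N)" and r: "bilinear_map K N H N r"
    and \<rho>: "linear_map K A (tensor K A H) \<rho>"
    and z: "inv\<^bsub>tensor3 K A H H\<^esub> \<Phi>\<^sub>\<rho> \<in> carrier (tensor3 K A H H)"
  defines "T \<equiv> tensor K A N"
  shows right_crossed_product_bilinear:
      "bilinear_map K T T T (mult (right_crossed_product K H A \<rho> \<Phi>\<^sub>\<rho> N r))" (is ?bil)
    and right_crossed_product_tens:
      "a \<in> carrier A \<Longrightarrow> n \<in> carrier N \<Longrightarrow> a' \<in> carrier A \<Longrightarrow> n' \<in> carrier N \<Longrightarrow>
        tens K A N a n \<otimes>\<^bsub>right_crossed_product K H A \<rho> \<Phi>\<^sub>\<rho> N r\<^esub> tens K A N a' n'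
        = tsum T (\<rho> a') (\<lambda>a0 a1. tsum3 T (inv\<^bsub>tensor3 K A H H\<^esub> \<Phi>\<^sub>\<rho>) (\<lambda>y1 y2 y3.
            tens K A N (a \<otimes>\<^bsub>A\<^esub> a0 \<otimes>\<^bsub>A\<^esub> y1) (r n (a1 \<otimes>\<^bsub>H\<^esub> y2) \<otimes>\<^bsub>N\<^esub> r n' y3)))" (is "PROP ?val")
proof -
  have T: "module K T" unfolding T_def by (rule tensor_module[OF m(2,3)])
  note t = tens_bilinear[OF m(2,3), folded T_def]
  note cl = bilinear_map_closed[OF H] bilinear_map_closed[OF A] bilinear_map_closed[OF N]
    bilinear_map_closed[OF r]
  note lin = tsum3_body_linear[OF m(2,1,1) T z] bilinear_map_comp_left[OF t] bilinear_map_comp_right[OF t]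
    bilinear_map_comp_left[OF A] bilinear_map_comp_right[OF A] bilinear_map_comp_left[OF N]
    bilinear_map_comp_right[OF N] bilinear_map_comp_left[OF r] bilinear_map_comp_right[OF r]
    bilinear_map_comp_left[OF H] bilinear_map_comp_right[OF H] linear_map_ident cl
  note \<rho>cl = linear_mapD(1)[OF \<rho>]
  \<comment> \<open>Of the four variables, \<open>a'\<close> alone sits inside the tensor summed
    over, as the argument of \<open>\<rho>\<close>; hence \<open>tsum_arg_linear\<close> in the
    third place.\<close>
  note b = tsum_tsum_bilinear[OF m(2,3,2,3) T, where f = "\<lambda>a n a' n'.
      tsum T (\<rho> a') (\<lambda>a0 a1. tsum3 T (inv\<^bsub>tensor3 K A H H\<^esub> \<Phi>\<^sub>\<rho>) (\<lambda>y1 y2 y3.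
            tens K A N (a \<otimes>\<^bsub>A\<^esub> a0 \<otimes>\<^bsub>A\<^esub> y1) (r n (a1 \<otimes>\<^bsub>H\<^esub> y2) \<otimes>\<^bsub>N\<^esub> r n' y3)))",
      OF tsum_body_linear[OF m(2,1) T] tsum_body_linear[OF m(2,1) T]
        tsum_arg_linear[OF m(2,1) T _ \<rho>] tsum_body_linear[OF m(2,1) T]]
  have e: "mult (right_crossed_product K H A \<rho> \<Phi>\<^sub>\<rho> N r) = (\<lambda>s t. tsum T s (\<lambda>a n. tsum T t (\<lambda>a' n'. 
      tsum T (\<rho> a') (\<lambda>a0 a1. tsum3 T (inv\<^bsub>tensor3 K A H H\<^esub> \<Phi>\<^sub>\<rho>) (\<lambda>y1 y2 y3.
            tens K A N (a \<otimes>\<^bsub>A\<^esub> a0 \<otimes>\<^bsub>A\<^esub> y1) (r n (a1 \<otimes>\<^bsub>H\<^esub> y2) \<otimes>\<^bsub>N\<^esub> r n' y3))))))"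
    by (simp add: right_crossed_product_def Let_def T_def)
  show ?bil unfolding e
    by (rule b(1)[folded T_def]; (rule \<rho>cl, assumption)?; (intro bilinear_mapI lin; assumption)?)
  show "PROP ?val" unfolding e
    by (rule b(2); (rule \<rho>cl, assumption)?; (intro bilinear_mapI lin; assumption)?)
qed

text \<open>The mirror image, applied with \<open>N\<close> equal to \<open>M\<close> and to the
  quasi-smash product of \<open>A\<close> and \<open>M\<close>. Here \<open>b\<close> is the
  variable that enters through the coaction.\<close>

lemma
  assumes m: "module K H" "module K B" "module K N"
    and H: "bilinear_map K H H H (mult H)" and B: "bilinear_map K B B B (mult B)"
    and N: "bilinear_map K N N N (mult N)" and l: "bilinear_map K H N N l"
    and \<Lambda>: "linear_map K B (tensor K H B) \<Lambda>"
    and z: "inv\<^bsub>tensor3 K H H B\<^esub> \<Phi>\<^sub>\<Lambda> \<in> carrier (tensor3 K H H B)"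
  defines "T \<equiv> tensor K N B"
  shows left_crossed_product_bilinear:
      "bilinear_map K T T T (mult (left_crossed_product K H N l B \<Lambda> \<Phi>\<^sub>\<Lambda>))" (is ?bil)
    and left_crossed_product_tens:
      "n \<in> carrier N \<Longrightarrow> b \<in> carrier B \<Longrightarrow> n' \<in> carrier N \<Longrightarrow> b' \<in> carrier B \<Longrightarrow>
        tens K N B n b \<otimes>\<^bsub>left_crossed_product K H N l B \<Lambda> \<Phi>\<^sub>\<Lambda>\<^esub> tens K N B n' b'
        = tsum T (\<Lambda> b) (\<lambda>b1 b0. tsum3 T (inv\<^bsub>tensor3 K H H B\<^esub> \<Phi>\<^sub>\<Lambda>) (\<lambda>x1 x2 x3.
            tens K N B (l x1 n \<otimes>\<^bsub>N\<^esub> l (x2 \<otimes>\<^bsub>H\<^esub> b1) n') (x3 \<otimes>\<^bsub>B\<^esub> b0 \<otimes>\<^bsub>B\<^esub> b')))" (is "PROP ?val")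
proof -
  have T: "module K T" unfolding T_def by (rule tensor_module[OF m(3,2)])
  note t = tens_bilinear[OF m(3,2), folded T_def]
  note cl = bilinear_map_closed[OF H] bilinear_map_closed[OF B] bilinear_map_closed[OF N]
    bilinear_map_closed[OF l]
  note lin = tsum3_body_linear[OF m(1,1,2) T z] bilinear_map_comp_left[OF t] bilinear_map_comp_right[OF t]
    bilinear_map_comp_left[OF B] bilinear_map_comp_right[OF B] bilinear_map_comp_left[OF N]
    bilinear_map_comp_right[OF N] bilinear_map_comp_left[OF l] bilinear_map_comp_right[OF l]
    bilinear_map_comp_left[OF H] bilinear_map_comp_right[OF H] linear_map_ident cl
  note \<Lambda>cl = linear_mapD(1)[OF \<Lambda>]
  note b = tsum_tsum_bilinear[OF m(3,2,3,2) T, where f = "\<lambda>n b n' b'.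
      tsum T (\<Lambda> b) (\<lambda>b1 b0. tsum3 T (inv\<^bsub>tensor3 K H H B\<^esub> \<Phi>\<^sub>\<Lambda>) (\<lambda>x1 x2 x3.
            tens K N B (l x1 n \<otimes>\<^bsub>N\<^esub> l (x2 \<otimes>\<^bsub>H\<^esub> b1) n') (x3 \<otimes>\<^bsub>B\<^esub> b0 \<otimes>\<^bsub>B\<^esub> b')))",
      OF tsum_body_linear[OF m(1,2) T] tsum_arg_linear[OF m(1,2) T _ \<Lambda>]
        tsum_body_linear[OF m(1,2) T] tsum_body_linear[OF m(1,2) T]]
  have e: "mult (left_crossed_product K H N l B \<Lambda> \<Phi>\<^sub>\<Lambda>) = (\<lambda>s t. tsum T s (\<lambda>n b. tsum T t (\<lambda>n' b'.
      tsum T (\<Lambda> b) (\<lambda>b1 b0. tsum3 T (inv\<^bsub>tensor3 K H H B\<^esub> \<Phi>\<^sub>\<Lambda>) (\<lambda>x1 x2 x3.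
            tens K N B (l x1 n \<otimes>\<^bsub>N\<^esub> l (x2 \<otimes>\<^bsub>H\<^esub> b1) n') (x3 \<otimes>\<^bsub>B\<^esub> b0 \<otimes>\<^bsub>B\<^esub> b'))))))"
    by (simp add: left_crossed_product_def Let_def T_def)
  show ?bil unfolding e
    by (rule b(1)[folded T_def]; (rule \<Lambda>cl, assumption)?; (intro bilinear_mapI lin; assumption)?)
  show "PROP ?val" unfolding e
    by (rule b(2); (rule \<Lambda>cl, assumption)?; (intro bilinear_mapI lin; assumption)?)
qed

section \<open>Actions on the quasi-smash products\<close>

lemma
  assumes m: "module K V" "module K W" "module K V'" "module K W'"
    and f: "linear_map K V V' f" and g: "linear_map K W W' g"
  shows tmap_linear: "linear_map K (tensor K V W) (tensor K V' W') (tmap K V' W' f g)" (is ?lin)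
    and tmap_tens: "v \<in> carrier V \<Longrightarrow> w \<in> carrier W \<Longrightarrow>
      tmap K V' W' f g (tens K V W v w) = tens K V' W' (f v) (g w)" (is "PROP ?val")
proof -
  note T = tensor_module[OF m(3,4)] and t = tens_bilinear[OF m(3,4)]
  have b: "bilinear_map K V W (tensor K V' W') (\<lambda>v w. tens K V' W' (f v) (g w))"
    by (intro bilinear_mapI bilinear_map_comp_left[OF t f] bilinear_map_comp_right[OF t g]
        linear_mapD(1)[OF f] linear_mapD(1)[OF g])
  show ?lin using tsum_linear[OF m(1,2) T b] by (simp add: tmap_def[abs_def])
  show "PROP ?val" by (simp add: tmap_def tsum_tens[OF m(1,2) T b])
qed

text \<open>The crossed product lemmas demand a bilinear action on the coefficient algebra; for the
  quasi-smash product this is the action on the factor \<open>M\<close> alone.\<close>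

lemma
  assumes m: "module K H" "module K A" "module K M" and l: "bilinear_map K H M M l"
  shows quasi_smash_left_action_bilinear:
      "bilinear_map K H (tensor K A M) (tensor K A M) (quasi_smash_left_action K A M l)"
    and quasi_smash_left_action_tens:
      "h \<in> carrier H \<Longrightarrow> a \<in> carrier A \<Longrightarrow> n \<in> carrier M \<Longrightarrow>
        quasi_smash_left_action K A M l h (tens K A M a n) = tens K A M a (l h n)"
proof -
  have i: "linear_map K A A id" by (simp add: linear_map_def)
  show "bilinear_map K H (tensor K A M) (tensor K A M) (quasi_smash_left_action K A M l)"
    unfolding quasi_smash_left_action_def
    by (intro bilinear_mapI tmap_linear m i bilinear_mapD(2)[OF l])
      (auto simp: tmap_def intro!: tsum_body_linear[OF m(2,3) tensor_module[OF m(2,3)]]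
        bilinear_map_comp_right[OF tens_bilinear[OF m(2,3)] bilinear_mapD(1)[OF l]])
  show "quasi_smash_left_action K A M l h (tens K A M a n) = tens K A M a (l h n)"
    if "h \<in> carrier H" "a \<in> carrier A" "n \<in> carrier M"
    using tmap_tens[OF m(2,3,2,3) i bilinear_mapD(2)[OF l that(1)] that(2,3)]
    by (simp add: quasi_smash_left_action_def)
qed

lemma
  assumes m: "module K H" "module K M" "module K B" and r: "bilinear_map K M H M r"
  shows quasi_smash_right_action_bilinear:
      "bilinear_map K (tensor K M B) H (tensor K M B) (quasi_smash_right_action K M B r)"
    and quasi_smash_right_action_tens:
      "n \<in> carrier M \<Longrightarrow> b \<in> carrier B \<Longrightarrow> h \<in> carrier H \<Longrightarrow>
        quasi_smash_right_action K M B r (tens K M B n b) h = tens K M B (r n h) b"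
proof -
  have i: "linear_map K B B id" by (simp add: linear_map_def)
  show "bilinear_map K (tensor K M B) H (tensor K M B) (quasi_smash_right_action K M B r)"
    unfolding quasi_smash_right_action_def
    by (intro bilinear_mapI tmap_linear m i bilinear_mapD(1)[OF r])
      (auto simp: tmap_def intro!: tsum_body_linear[OF m(2,3) tensor_module[OF m(2,3)]]
        bilinear_map_comp_left[OF tens_bilinear[OF m(2,3)] bilinear_mapD(2)[OF r]])
  show "quasi_smash_right_action K M B r (tens K M B n b) h = tens K M B (r n h) b"
    if "n \<in> carrier M" "b \<in> carrier B" "h \<in> carrier H"
    using tmap_tens[OF m(2,3,2,3) bilinear_mapD(1)[OF r that(3)] i that(1,2)]
    by (simp add: quasi_smash_right_action_def)
qed

section \<open>Rebracketing of threefold tensor products\<close>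

lemma
  assumes m: "module K U" "module K V" "module K W"
  shows assoc_right_linear:
      "linear_map K (tensor3 K U V W) (tensor K U (tensor K V W)) (assoc_right K U V W)" (is ?lin)
    and assoc_right_tens: "u \<in> carrier U \<Longrightarrow> v \<in> carrier V \<Longrightarrow> w \<in> carrier W \<Longrightarrow>
      assoc_right K U V W (tens3 K U V W u v w) = tens K U (tensor K V W) u (tens K V W v w)"
        (is "PROP ?val")
proof -
  note UV = tensor_module[OF m(1,2)] and VW = tensor_module[OF m(2,3)]
  note T = tensor_module[OF m(1) VW] and t = tens_bilinear[OF m(1) VW] and t' = tens_bilinear[OF m(2,3)]
  have 1: "bilinear_map K U V (tensor K U (tensor K V W))
      (\<lambda>u v. tens K U (tensor K V W) u (tens K V W v w))" if "w \<in> carrier W" for w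
    using that by (intro bilinear_mapI bilinear_mapD(1)[OF t] bilinear_map_comp_right[OF t bilinear_mapD(1)[OF t']]
        bilinear_map_closed[OF t'])
  have 2: "bilinear_map K (tensor K U V) W (tensor K U (tensor K V W))
      (\<lambda>s w. tsum (tensor K U (tensor K V W)) s (\<lambda>u v. tens K U (tensor K V W) u (tens K V W v w)))"
    by (intro bilinear_mapI tsum_linear[OF m(1,2) T 1] tsum_body_linear[OF m(1,2) T]
        bilinear_map_comp_right[OF t bilinear_mapD(2)[OF t']])
  show ?lin using tsum_linear[OF UV m(3) T 2] by (simp add: assoc_right_def[abs_def] tsum3_def)
  show "PROP ?val"
    by (simp add: assoc_right_def tsum3_def tsum_tens[OF UV m(3) T 2] tsum_tens[OF m(1,2) T 1] tens_closed m)
qed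

lemma
  assumes m: "module K U" "module K V" "module K W"
  shows assoc_left_linear:
      "linear_map K (tensor K U (tensor K V W)) (tensor3 K U V W) (assoc_left K U V W)" (is ?lin)
    and assoc_left_tens: "u \<in> carrier U \<Longrightarrow> v \<in> carrier V \<Longrightarrow> w \<in> carrier W \<Longrightarrow>
      assoc_left K U V W (tens K U (tensor K V W) u (tens K V W v w)) = tens3 K U V W u v w"
        (is "PROP ?val")
proof -
  note UV = tensor_module[OF m(1,2)] and VW = tensor_module[OF m(2,3)]
  note T = tensor_module[OF UV m(3)] and t = tens_bilinear[OF UV m(3)] and t' = tens_bilinear[OF m(1,2)]
  have 1: "bilinear_map K V W (tensor3 K U V W) (\<lambda>v w. tens3 K U V W u v w)" if "u \<in> carrier U" for u
    using that by (intro bilinear_mapI bilinear_mapD(2)[OF t] bilinear_map_comp_left[OF t bilinear_mapD(2)[OF t']]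
        bilinear_map_closed[OF t'])
  have 2: "bilinear_map K U (tensor K V W) (tensor3 K U V W)
      (\<lambda>u s. tsum (tensor3 K U V W) s (\<lambda>v w. tens3 K U V W u v w))"
    by (intro bilinear_mapI tsum_linear[OF m(2,3) T 1] tsum_body_linear[OF m(2,3) T]
        bilinear_map_comp_left[OF t bilinear_mapD(1)[OF t']])
  show ?lin using tsum_linear[OF m(1) VW T 2] by (simp add: assoc_left_def[abs_def])
  show "PROP ?val"
    by (simp add: assoc_left_def tsum_tens[OF m(1) VW T 2] tsum_tens[OF m(2,3) T 1] tens_closed m)
qed

text \<open>Both composites with \<open>assoc_left\<close> are linear and fix the pure tensors,
  which span.\<close>

lemma assoc_right_bij:
  assumes m: "module K U" "module K V" "module K W"
  shows "bij_betw (assoc_right K U V W) (carrier (tensor3 K U V W)) (carrier (tensor K U (tensor K V W)))"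
proof (rule bij_betw_byWitness[where f' = "assoc_left K U V W"])
  note UV = tensor_module[OF m(1,2)] and VW = tensor_module[OF m(2,3)]
  note L = assoc_left_linear[OF m] and R = assoc_right_linear[OF m]
  note eqs = assoc_left_tens[OF m] assoc_right_tens[OF m]
  show "assoc_right K U V W ` carrier (tensor3 K U V W) \<subseteq> carrier (tensor K U (tensor K V W))"
    using linear_mapD(1)[OF R] by auto
  show "assoc_left K U V W ` carrier (tensor K U (tensor K V W)) \<subseteq> carrier (tensor3 K U V W)"
    using linear_mapD(1)[OF L] by auto
  show "\<forall>t\<in>carrier (tensor3 K U V W). assoc_left K U V W (assoc_right K U V W t) = t"
  proof
    fix t assume t: "t \<in> carrier (tensor3 K U V W)"
    note T = tensor_module[OF UV m(3)]
    have "assoc_left K U V W (assoc_right K U V W t) = tsum3 (tensor3 K U V W) t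
        (\<lambda>u v w. assoc_left K U V W (assoc_right K U V W (tens3 K U V W u v w)))"
      by (rule linear_map_tsum3_tens3[OF m T linear_map_comp[OF L R] t])
    also have "\<dots> = tsum3 (tensor3 K U V W) t (\<lambda>u v w. tens3 K U V W u v w)"
      by (rule tsum3_cong[OF m t]) (simp add: eqs)
    also have "\<dots> = t"
      by (rule linear_map_tsum3_tens3[OF m T linear_map_ident t, symmetric])
    finally show "assoc_left K U V W (assoc_right K U V W t) = t" .
  qed
  show "\<forall>t\<in>carrier (tensor K U (tensor K V W)). assoc_right K U V W (assoc_left K U V W t) = t"
  proof
    fix t assume t: "t \<in> carrier (tensor K U (tensor K V W))"
    note T = tensor_module[OF m(1) VW] and b = tens_bilinear[OF m(1) VW]
    show "assoc_right K U V W (assoc_left K U V W t) = t"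
    \<comment> \<open>\<open>tsum3\<close> expands left-bracketed tensors only. For the
      right-bracketed product the reduction to pure tensors is done in two stages, first for the
      outer tensor and then for its second factor \<open>s\<close>.\<close>
    proof (rule linear_map_eq_on_tens[OF m(1) VW T linear_map_comp[OF R L] linear_map_ident _ t])
      fix u s assume u: "u \<in> carrier U" and s: "s \<in> carrier (tensor K V W)"
      show "assoc_right K U V W (assoc_left K U V W (tens K U (tensor K V W) u s)) = tens K U (tensor K V W) u s"
        by (rule linear_map_eq_on_tens[OF m(2,3) T linear_map_comp[OF linear_map_comp[OF R L]
              bilinear_mapD(2)[OF b u]] bilinear_mapD(2)[OF b u] _ s]) (simp add: u eqs)
    qed
  qed
qed


section \<open>The two isomorphisms\<close>

text \<open>Makes two things visible: the inner multiplication is one already computed for crossed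
  products, and the record is an explicit \<open>mult\<close> update, which
  \<open>mult_update_simps\<close> removes inside an outer tensor product.\<close>

lemma quasi_smash_left_eq:
  "quasi_smash_left K H A \<rho> \<Phi>\<^sub>\<rho> M r =
    tensor K A M\<lparr>mult := mult (right_crossed_product K H A \<rho> \<Phi>\<^sub>\<rho> M r)\<rparr>"
  by (simp add: quasi_smash_left_def right_crossed_product_def Let_def)

lemma quasi_smash_right_eq:
  "quasi_smash_right K H M l B \<Lambda> \<Phi>\<^sub>\<Lambda> =
    tensor K M B\<lparr>mult := mult (left_crossed_product K H M l B \<Lambda> \<Phi>\<^sub>\<Lambda>)\<rparr>"
  by (simp add: quasi_smash_right_def left_crossed_product_def Let_def)

lemma assoc_algebra_inv_closed:
  assumes "assoc_algebra K A" "u \<in> Units A"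
  shows "inv\<^bsub>A\<^esub> u \<in> carrier A"
proof -
  interpret ring A using assms(1) by (rule assoc_algebraD)
  show ?thesis using assms(2) by simp
qed

theorem proposition8p2:
  fixes K :: "'k ring" and H :: "('k, 'h) module" and A :: "('k, 'a) module"
    and B :: "('k, 'b) module" and M :: "('k, 'm) module"
  assumes "quasi_bialgebra K H \<Delta> \<epsilon> \<Phi>"
    and "right_comodule_algebra K H \<Delta> \<epsilon> \<Phi> A \<rho> \<Phi>\<^sub>\<rho>"
    and "left_comodule_algebra K H \<Delta> \<epsilon> \<Phi> B \<Lambda> \<Phi>\<^sub>\<Lambda>"
    and "bimodule_algebra K H \<Delta> \<epsilon> \<Phi> M l r"
  shows "id \<in> algebra_iso K
      (two_sided_crossed_product K H A \<rho> \<Phi>\<^sub>\<rho> M l r B \<Lambda> \<Phi>\<^sub>\<Lambda>)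
      (left_crossed_product K H
        (quasi_smash_left K H A \<rho> \<Phi>\<^sub>\<rho> M r) (quasi_smash_left_action K A M l) B \<Lambda> \<Phi>\<^sub>\<Lambda>) \<and>
    assoc_right K A M B \<in> algebra_iso K
      (two_sided_crossed_product K H A \<rho> \<Phi>\<^sub>\<rho> M l r B \<Lambda> \<Phi>\<^sub>\<Lambda>)
      (right_crossed_product K H A \<rho> \<Phi>\<^sub>\<rho>
        (quasi_smash_right K H M l B \<Lambda> \<Phi>\<^sub>\<Lambda>) (quasi_smash_right_action K M B r))"
proof -
  interpret right_comodule_algebra K H \<Delta> \<epsilon> \<Phi> A \<rho> \<Phi>\<^sub>\<rho> by fact
  interpret L: left_comodule_algebra K H \<Delta> \<epsilon> \<Phi> B \<Lambda> \<Phi>\<^sub>\<Lambda> by fact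
  interpret M: bimodule_algebra K H \<Delta> \<epsilon> \<Phi> M l r by fact
  note H = assoc_algebraD(2,4)[OF H_algebra] and A = assoc_algebraD(2,4)[OF A_algebra]
    and B = assoc_algebraD(2,4)[OF L.B_algebra]
  have M: "module K M" "bilinear_map K M M M (mult M)"
    using M.M_algebra by (auto simp: unital_nonassoc_algebra_def)
  note l = M.left_bilinear and r = M.right_bilinear
  have \<rho>: "linear_map K A (tensor K A H) \<rho>" and \<Lambda>: "linear_map K B (tensor K H B) \<Lambda>"
    using right_coaction_hom L.left_coaction_hom by (auto simp: algebra_hom_def)
  define z where "z = inv\<^bsub>tensor3 K A H H\<^esub> \<Phi>\<^sub>\<rho>"
  define w where "w = inv\<^bsub>tensor3 K H H B\<^esub> \<Phi>\<^sub>\<Lambda>"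
  have z: "z \<in> carrier (tensor3 K A H H)" unfolding z_def
    by (intro assoc_algebra_inv_closed[where K = K] tensor_assoc_algebra A_algebra H_algebra right_coaction_reassociator_unit)
  have w: "w \<in> carrier (tensor3 K H H B)" unfolding w_def
    by (intro assoc_algebra_inv_closed[where K = K] tensor_assoc_algebra L.B_algebra H_algebra L.left_coaction_reassociator_unit)
  note AM = tensor_module[OF A(1) M(1)] and MB = tensor_module[OF M(1) B(1)]
  note TL = tensor_module[OF AM B(1)] and TR = tensor_module[OF A(1) MB]
  let ?AM = "tensor K A M" and ?MB = "tensor K M B"
  let ?TL = "tensor K ?AM B" and ?TR = "tensor K A ?MB"
  \<comment> \<open>\<open>?q\<close> and \<open>?p\<close> are the multiplications of the two inner
    quasi-smash products; \<open>?Q\<close> and \<open>?P\<close> are these products as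
    records.\<close>
  let ?q = "mult (right_crossed_product K H A \<rho> \<Phi>\<^sub>\<rho> M r)"
  let ?p = "mult (left_crossed_product K H M l B \<Lambda> \<Phi>\<^sub>\<Lambda>)"
  let ?Q = "?AM\<lparr>mult := ?q\<rparr>" and ?P = "?MB\<lparr>mult := ?p\<rparr>"
  let ?l = "quasi_smash_left_action K A M l" and ?r = "quasi_smash_right_action K M B r"
  let ?S = "two_sided_crossed_product K H A \<rho> \<Phi>\<^sub>\<rho> M l r B \<Lambda> \<Phi>\<^sub>\<Lambda>"
  let ?LC = "left_crossed_product K H ?Q ?l B \<Lambda> \<Phi>\<^sub>\<Lambda>"
  let ?RC = "right_crossed_product K H A \<rho> \<Phi>\<^sub>\<rho> ?P ?r"
  let ?F = "assoc_right K A M B"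
  note F = assoc_right_linear[OF A(1) M(1) B(1)] and F_tens = assoc_right_tens[OF A(1) M(1) B(1)]
  note cl = bilinear_map_closed[OF H(2)] bilinear_map_closed[OF A(2)] bilinear_map_closed[OF B(2)]
    bilinear_map_closed[OF M(2)] bilinear_map_closed[OF l] bilinear_map_closed[OF r] tens_closed
    AM MB TL TR A(1) B(1) M(1) H(1)
  note \<rho>cl = linear_mapD(1)[OF \<rho>] and \<Lambda>cl = linear_mapD(1)[OF \<Lambda>]
  note l' = quasi_smash_left_action_bilinear[OF H(1) A(1) M(1) l]
    and l'_tens = quasi_smash_left_action_tens[OF H(1) A(1) M(1) l]
  note r' = quasi_smash_right_action_bilinear[OF H(1) M(1) B(1) r]
    and r'_tens = quasi_smash_right_action_tens[OF H(1) M(1) B(1) r]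
  note q = right_crossed_product_bilinear[OF H(1) A(1) M(1) H(2) A(2) M(2) r \<rho> z[unfolded z_def]]
    and q_tens = right_crossed_product_tens[OF H(1) A(1) M(1) H(2) A(2) M(2) r \<rho> z[unfolded z_def],
        folded z_def]
  note p = left_crossed_product_bilinear[OF H(1) B(1) M(1) H(2) B(2) M(2) l \<Lambda> w[unfolded w_def]]
    and p_tens = left_crossed_product_tens[OF H(1) B(1) M(1) H(2) B(2) M(2) l \<Lambda> w[unfolded w_def],
        folded w_def]
  \<comment> \<open>The generic lemma with the quasi-smash product \<open>?Q\<close> as
    coefficients; \<open>q\<close> and \<open>l'\<close> supply its bilinearity premises, and every
    tensor product formed with \<open>?Q\<close> is rewritten to one formed with
    \<open>?AM\<close>.\<close>
  have LC: "bilinear_map K ?TL ?TL ?TL (mult ?LC)"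
    and LC_tens: "\<And>n b n' b'. n \<in> carrier ?AM \<Longrightarrow> b \<in> carrier B \<Longrightarrow> n' \<in> carrier ?AM \<Longrightarrow> b' \<in> carrier B \<Longrightarrow>
      tens K ?AM B n b \<otimes>\<^bsub>?LC\<^esub> tens K ?AM B n' b'
        = tsum ?TL (\<Lambda> b) (\<lambda>b1 b0. tsum3 ?TL w (\<lambda>x1 x2 x3.
            tens K ?AM B (?q (?l x1 n) (?l (x2 \<otimes>\<^bsub>H\<^esub> b1) n')) (x3 \<otimes>\<^bsub>B\<^esub> b0 \<otimes>\<^bsub>B\<^esub> b')))"
    using left_crossed_product_bilinear[of K H B ?Q ?l \<Lambda> \<Phi>\<^sub>\<Lambda>]
      left_crossed_product_tens[of K H B ?Q ?l \<Lambda> \<Phi>\<^sub>\<Lambda>]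
    by (simp_all add: mult_update_simps AM H B q l' \<Lambda> w flip: w_def add: tsum3_def)
  have RC: "bilinear_map K ?TR ?TR ?TR (mult ?RC)"
    and RC_tens: "\<And>a n a' n'. a \<in> carrier A \<Longrightarrow> n \<in> carrier ?MB \<Longrightarrow> a' \<in> carrier A \<Longrightarrow> n' \<in> carrier ?MB \<Longrightarrow>
      tens K A ?MB a n \<otimes>\<^bsub>?RC\<^esub> tens K A ?MB a' n'
        = tsum ?TR (\<rho> a') (\<lambda>a0 a1. tsum3 ?TR z (\<lambda>y1 y2 y3.
            tens K A ?MB (a \<otimes>\<^bsub>A\<^esub> a0 \<otimes>\<^bsub>A\<^esub> y1) (?p (?r n (a1 \<otimes>\<^bsub>H\<^esub> y2)) (?r n' y3))))"
    using right_crossed_product_bilinear[of K H A ?P ?r \<rho> \<Phi>\<^sub>\<rho>]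
      right_crossed_product_tens[of K H A ?P ?r \<rho> \<Phi>\<^sub>\<rho>]
    by (simp_all add: mult_update_simps MB H A p r' \<rho> z flip: z_def add: tsum3_def)

  \<comment> \<open>\<open>G\<close> is the summand shared by all three products, and
    \<open>S\<close> is the value that they are to have on two pure tensors. The order of summation
    in \<open>S\<close> is the one in the definition of the two-sided product.\<close>
  define G where "G a m m' b' a0 a1 b1 b0 y1 y2 y3 x1 x2 x3 = tens3 K A M B
          (a \<otimes>\<^bsub>A\<^esub> a0 \<otimes>\<^bsub>A\<^esub> y1)
          (r (l x1 m) (a1 \<otimes>\<^bsub>H\<^esub> y2) \<otimes>\<^bsub>M\<^esub> r (l (x2 \<otimes>\<^bsub>H\<^esub> b1) m') y3)
          (x3 \<otimes>\<^bsub>B\<^esub> b0 \<otimes>\<^bsub>B\<^esub> b')" for a m m' b' a0 a1 b1 b0 y1 y2 y3 x1 x2 x3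
  define S where "S a m b a' m' b' = tsum ?TL (\<rho> a') (\<lambda>a0 a1. tsum ?TL (\<Lambda> b) (\<lambda>b1 b0.
      tsum3 ?TL z (\<lambda>y1 y2 y3. tsum3 ?TL w (\<lambda>x1 x2 x3.
        G a m m' b' a0 a1 b1 b0 y1 y2 y3 x1 x2 x3))))" for a m b a' m' b'
  \<comment> \<open>True by definition: the two-sided multiplication is already a sum of values of
    \<open>S\<close>. It is the crossed products that have to be expanded by bilinearity to match
    it.\<close>
  have S_mult: "s \<otimes>\<^bsub>?S\<^esub> t = tsum3 ?TL s (\<lambda>a m b. tsum3 ?TL t (\<lambda>a' m' b'. S a m b a' m' b'))" for s t
    by (simp add: two_sided_crossed_product_def Let_def S_def G_def z_def w_def)
  note T3 = tsum3_closed[OF A(1) H(1) H(1) TL z] tsum3_closed[OF H(1) H(1) B(1) TL w]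
    tsum_closed[OF A(1) H(1) TL] tsum_closed[OF H(1) B(1) TL]
  have G: "G a m m' b' a0 a1 b1 b0 y1 y2 y3 x1 x2 x3 \<in> carrier ?TL"
    if "a \<in> carrier A" "m \<in> carrier M" "m' \<in> carrier M" "b' \<in> carrier B"
      "a0 \<in> carrier A" "a1 \<in> carrier H" "b1 \<in> carrier H" "b0 \<in> carrier B"
      "y1 \<in> carrier A" "y2 \<in> carrier H" "y3 \<in> carrier H" "x1 \<in> carrier H" "x2 \<in> carrier H" "x3 \<in> carrier B"
    for a m m' b' a0 a1 b1 b0 y1 y2 y3 x1 x2 x3
    using that by (simp add: G_def cl)
  have S: "S a m b a' m' b' \<in> carrier ?TL"
    if "a \<in> carrier A" "m \<in> carrier M" "b \<in> carrier B" "a' \<in> carrier A" "m' \<in> carrier M" "b' \<in> carrier B"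
    for a m b a' m' b'
    using that unfolding S_def by (intro T3 \<rho>cl \<Lambda>cl G)

  have left_tens: "tens3 K A M B a m b \<otimes>\<^bsub>?LC\<^esub> tens3 K A M B a' m' b' = S a m b a' m' b'"
    if c: "a \<in> carrier A" "m \<in> carrier M" "b \<in> carrier B" "a' \<in> carrier A" "m' \<in> carrier M" "b' \<in> carrier B"
    for a m b a' m' b'
  proof -
    have "tens3 K A M B a m b \<otimes>\<^bsub>?LC\<^esub> tens3 K A M B a' m' b'
      = tsum ?TL (\<Lambda> b) (\<lambda>b1 b0. tsum3 ?TL w (\<lambda>x1 x2 x3.
            tens K ?AM B (?q (tens K A M a (l x1 m)) (tens K A M a' (l (x2 \<otimes>\<^bsub>H\<^esub> b1) m')))
              (x3 \<otimes>\<^bsub>B\<^esub> b0 \<otimes>\<^bsub>B\<^esub> b')))"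
      unfolding LC_tens[OF tens_closed[OF A(1) M(1) c(1,2)] c(3) tens_closed[OF A(1) M(1) c(4,5)] c(6)]
      by (intro tsum_cong[OF H(1) B(1) \<Lambda>cl] tsum3_cong[OF H(1) H(1) B(1) w] c) (simp add: l'_tens cl c)
    also have "\<dots> = tsum ?TL (\<Lambda> b) (\<lambda>b1 b0. tsum3 ?TL w (\<lambda>x1 x2 x3.
        tsum ?TL (\<rho> a') (\<lambda>a0 a1. tsum3 ?TL z (\<lambda>y1 y2 y3.
          G a m m' b' a0 a1 b1 b0 y1 y2 y3 x1 x2 x3))))"
    proof (intro tsum_cong[OF H(1) B(1) \<Lambda>cl] tsum3_cong[OF H(1) H(1) B(1) w] c)
      fix b1 b0 x1 x2 x3
      assume d: "b1 \<in> carrier H" "b0 \<in> carrier B" "x1 \<in> carrier H" "x2 \<in> carrier H" "x3 \<in> carrier B"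
      let ?b = "x3 \<otimes>\<^bsub>B\<^esub> b0 \<otimes>\<^bsub>B\<^esub> b'"
      \<comment> \<open>Tensoring with the fixed last factor is linear, so it carries the sums of
        the inner product out to \<open>?TL\<close>.\<close>
      have lin: "linear_map K ?AM ?TL (\<lambda>u. tens K ?AM B u ?b)"
        by (rule bilinear_mapD(1)[OF tens_bilinear[OF AM B(1)]]) (simp add: cl c d)
      let ?g = "\<lambda>a0 a1 y1 y2 y3. tens K A M (a \<otimes>\<^bsub>A\<^esub> a0 \<otimes>\<^bsub>A\<^esub> y1)
          (r (l x1 m) (a1 \<otimes>\<^bsub>H\<^esub> y2) \<otimes>\<^bsub>M\<^esub> r (l (x2 \<otimes>\<^bsub>H\<^esub> b1) m') y3)"
      have "?q (tens K A M a (l x1 m)) (tens K A M a' (l (x2 \<otimes>\<^bsub>H\<^esub> b1) m'))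
        = tsum ?AM (\<rho> a') (\<lambda>a0 a1. tsum3 ?AM z (?g a0 a1))"
        by (rule q_tens) (simp_all add: cl c d)
      also have "tens K ?AM B \<dots> ?b = tsum ?TL (\<rho> a') (\<lambda>a0 a1. tens K ?AM B (tsum3 ?AM z (?g a0 a1)) ?b)"
        by (rule linear_map_tsum[OF A(1) H(1) AM TL \<rho>cl[OF c(4)] lin],
            rule tsum3_closed[OF A(1) H(1) H(1) AM z]) (simp add: cl c d)
      also have "\<dots> = tsum ?TL (\<rho> a') (\<lambda>a0 a1. tsum3 ?TL z (\<lambda>y1 y2 y3.
          G a m m' b' a0 a1 b1 b0 y1 y2 y3 x1 x2 x3))"
        unfolding G_def
        by (rule tsum_cong[OF A(1) H(1) \<rho>cl[OF c(4)]],
            rule linear_map_tsum3[OF A(1) H(1) H(1) AM TL z lin]) (simp add: cl c d)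
      finally show "tens K ?AM B (?q (tens K A M a (l x1 m)) (tens K A M a' (l (x2 \<otimes>\<^bsub>H\<^esub> b1) m'))) ?b
        = tsum ?TL (\<rho> a') (\<lambda>a0 a1. tsum3 ?TL z (\<lambda>y1 y2 y3.
          G a m m' b' a0 a1 b1 b0 y1 y2 y3 x1 x2 x3))" .
    qed
    \<comment> \<open>The sums now run over \<open>\<Lambda> b\<close>, \<open>w\<close>,
      \<open>\<rho> a'\<close>, \<open>z\<close>, from the outside in, whereas \<open>S\<close> has
      \<open>\<rho> a'\<close>, \<open>\<Lambda> b\<close>, \<open>z\<close>, \<open>w\<close>.
      Three exchanges follow: \<open>w\<close> with \<open>\<rho> a'\<close>, then \<open>w\<close>
      with \<open>z\<close>, then \<open>\<Lambda> b\<close> with \<open>\<rho> a'\<close>.\<close>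
    also have "\<dots> = tsum ?TL (\<Lambda> b) (\<lambda>b1 b0. tsum ?TL (\<rho> a') (\<lambda>a0 a1.
        tsum3 ?TL w (\<lambda>x1 x2 x3. tsum3 ?TL z (\<lambda>y1 y2 y3.
          G a m m' b' a0 a1 b1 b0 y1 y2 y3 x1 x2 x3))))"
      by (rule tsum_cong[OF H(1) B(1) \<Lambda>cl[OF c(3)]],
          rule tsum3_tsum_swap[OF H(1) H(1) B(1) A(1) H(1) TL w \<rho>cl[OF c(4)]])
        (intro T3 G c; assumption)
    also have "\<dots> = tsum ?TL (\<Lambda> b) (\<lambda>b1 b0. tsum ?TL (\<rho> a') (\<lambda>a0 a1.
        tsum3 ?TL z (\<lambda>y1 y2 y3. tsum3 ?TL w (\<lambda>x1 x2 x3.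
          G a m m' b' a0 a1 b1 b0 y1 y2 y3 x1 x2 x3))))"
      by (rule tsum_cong[OF H(1) B(1) \<Lambda>cl[OF c(3)]], rule tsum_cong[OF A(1) H(1) \<rho>cl[OF c(4)]],
          rule tsum3_swap[OF H(1) H(1) B(1) A(1) H(1) H(1) TL w z])
        (intro G c; assumption)
    also have "\<dots> = S a m b a' m' b'"
      unfolding S_def
      by (rule tsum_swap[OF H(1) B(1) A(1) H(1) TL \<Lambda>cl[OF c(3)] \<rho>cl[OF c(4)]])
        (intro T3 G c; assumption)
    finally show ?thesis .
  qed

  have right_tens: "tens K A ?MB a (tens K M B m b) \<otimes>\<^bsub>?RC\<^esub> tens K A ?MB a' (tens K M B m' b')
      = ?F (S a m b a' m' b')"
    if c: "a \<in> carrier A" "m \<in> carrier M" "b \<in> carrier B" "a' \<in> carrier A" "m' \<in> carrier M" "b' \<in> carrier B"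
    for a m b a' m' b'
  proof -
    have "tens K A ?MB a (tens K M B m b) \<otimes>\<^bsub>?RC\<^esub> tens K A ?MB a' (tens K M B m' b')
      = tsum ?TR (\<rho> a') (\<lambda>a0 a1. tsum3 ?TR z (\<lambda>y1 y2 y3. tens K A ?MB (a \<otimes>\<^bsub>A\<^esub> a0 \<otimes>\<^bsub>A\<^esub> y1)
          (?p (tens K M B (r m (a1 \<otimes>\<^bsub>H\<^esub> y2)) b) (tens K M B (r m' y3) b'))))"
      unfolding RC_tens[OF c(1) tens_closed[OF M(1) B(1) c(2,3)] c(4) tens_closed[OF M(1) B(1) c(5,6)]]
      by (intro tsum_cong[OF A(1) H(1) \<rho>cl] tsum3_cong[OF A(1) H(1) H(1) z] c) (simp add: r'_tens cl c)
    also have "\<dots> = tsum ?TR (\<rho> a') (\<lambda>a0 a1. tsum3 ?TR z (\<lambda>y1 y2 y3.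
        ?F (tsum ?TL (\<Lambda> b) (\<lambda>b1 b0. tsum3 ?TL w (\<lambda>x1 x2 x3.
          G a m m' b' a0 a1 b1 b0 y1 y2 y3 x1 x2 x3)))))"
    proof (intro tsum_cong[OF A(1) H(1) \<rho>cl] tsum3_cong[OF A(1) H(1) H(1) z] c)
      fix a0 a1 y1 y2 y3
      assume d: "a0 \<in> carrier A" "a1 \<in> carrier H" "y1 \<in> carrier A" "y2 \<in> carrier H" "y3 \<in> carrier H"
      let ?a = "a \<otimes>\<^bsub>A\<^esub> a0 \<otimes>\<^bsub>A\<^esub> y1"
      have lin: "linear_map K ?MB ?TR (tens K A ?MB ?a)"
        by (rule bilinear_mapD(2)[OF tens_bilinear[OF A(1) MB]]) (simp add: cl c d)
      let ?g = "\<lambda>b1 b0 x1 x2 x3. tens K M B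
          (l x1 (r m (a1 \<otimes>\<^bsub>H\<^esub> y2)) \<otimes>\<^bsub>M\<^esub> l (x2 \<otimes>\<^bsub>H\<^esub> b1) (r m' y3)) (x3 \<otimes>\<^bsub>B\<^esub> b0 \<otimes>\<^bsub>B\<^esub> b')"
      let ?G = "\<lambda>b1 b0 x1 x2 x3. G a m m' b' a0 a1 b1 b0 y1 y2 y3 x1 x2 x3"
      have "?p (tens K M B (r m (a1 \<otimes>\<^bsub>H\<^esub> y2)) b) (tens K M B (r m' y3) b')
        = tsum ?MB (\<Lambda> b) (\<lambda>b1 b0. tsum3 ?MB w (?g b1 b0))"
        by (rule p_tens) (simp_all add: cl c d)
      also have "tens K A ?MB ?a \<dots> = tsum ?TR (\<Lambda> b) (\<lambda>b1 b0. tens K A ?MB ?a (tsum3 ?MB w (?g b1 b0)))"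
        by (rule linear_map_tsum[OF H(1) B(1) MB TR \<Lambda>cl[OF c(3)] lin],
            rule tsum3_closed[OF H(1) H(1) B(1) MB w]) (simp add: cl c d)
      also have "\<dots> = tsum ?TR (\<Lambda> b) (\<lambda>b1 b0. tsum3 ?TR w (\<lambda>x1 x2 x3. tens K A ?MB ?a (?g b1 b0 x1 x2 x3)))"
        by (rule tsum_cong[OF H(1) B(1) \<Lambda>cl[OF c(3)]],
            rule linear_map_tsum3[OF H(1) H(1) B(1) MB TR w lin]) (simp add: cl c d)
      also have "\<dots> = tsum ?TR (\<Lambda> b) (\<lambda>b1 b0. tsum3 ?TR w (\<lambda>x1 x2 x3. ?F (?G b1 b0 x1 x2 x3)))"
        by (intro tsum_cong[OF H(1) B(1) \<Lambda>cl] tsum3_cong[OF H(1) H(1) B(1) w] c)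
          (simp add: G_def F_tens M.left_right cl c d)
      also have "\<dots> = tsum ?TR (\<Lambda> b) (\<lambda>b1 b0. ?F (tsum3 ?TL w (?G b1 b0)))"
        by (rule tsum_cong[OF H(1) B(1) \<Lambda>cl[OF c(3)]],
            rule linear_map_tsum3[OF H(1) H(1) B(1) TL TR w F, symmetric]) (intro G c d; assumption)
      also have "\<dots> = ?F (tsum ?TL (\<Lambda> b) (\<lambda>b1 b0. tsum3 ?TL w (?G b1 b0)))"
        by (rule linear_map_tsum[OF H(1) B(1) TL TR \<Lambda>cl[OF c(3)] F, symmetric])
          (intro T3 G c d; assumption)
      finally show "tens K A ?MB ?a (?p (tens K M B (r m (a1 \<otimes>\<^bsub>H\<^esub> y2)) b) (tens K M B (r m' y3) b'))
        = ?F (tsum ?TL (\<Lambda> b) (\<lambda>b1 b0. tsum3 ?TL w (?G b1 b0)))" .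
    qed
    also have "\<dots> = tsum ?TR (\<rho> a') (\<lambda>a0 a1. ?F (tsum3 ?TL z (\<lambda>y1 y2 y3.
        tsum ?TL (\<Lambda> b) (\<lambda>b1 b0. tsum3 ?TL w (\<lambda>x1 x2 x3.
          G a m m' b' a0 a1 b1 b0 y1 y2 y3 x1 x2 x3)))))"
      by (rule tsum_cong[OF A(1) H(1) \<rho>cl[OF c(4)]],
          rule linear_map_tsum3[OF A(1) H(1) H(1) TL TR z F, symmetric])
        (intro T3 \<Lambda>cl G c; assumption)
    \<comment> \<open>The order is now \<open>\<rho> a'\<close>, \<open>z\<close>,
      \<open>\<Lambda> b\<close>, \<open>w\<close>, so a single exchange reaches the order of
      \<open>S\<close>.\<close>
    also have "\<dots> = tsum ?TR (\<rho> a') (\<lambda>a0 a1. ?F (tsum ?TL (\<Lambda> b) (\<lambda>b1 b0.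
        tsum3 ?TL z (\<lambda>y1 y2 y3. tsum3 ?TL w (\<lambda>x1 x2 x3.
          G a m m' b' a0 a1 b1 b0 y1 y2 y3 x1 x2 x3)))))"
      by (rule tsum_cong[OF A(1) H(1) \<rho>cl[OF c(4)]], rule arg_cong[where f = ?F],
          rule tsum3_tsum_swap[OF A(1) H(1) H(1) H(1) B(1) TL z \<Lambda>cl[OF c(3)]])
        (intro T3 G c; assumption)
    also have "\<dots> = ?F (S a m b a' m' b')"
      unfolding S_def
      by (rule linear_map_tsum[OF A(1) H(1) TL TR \<rho>cl[OF c(4)] F, symmetric])
        (intro T3 \<Lambda>cl G c; assumption)
    finally show ?thesis .
  qed

  have left_mult: "s \<otimes>\<^bsub>?S\<^esub> t = s \<otimes>\<^bsub>?LC\<^esub> t" if s: "s \<in> carrier ?TL" and t: "t \<in> carrier ?TL" for s t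
    unfolding S_mult bilinear_map_tsum3_tens3[OF A(1) M(1) B(1) A(1) M(1) B(1) TL LC s t]
    by (intro tsum3_cong[OF A(1) M(1) B(1) s] tsum3_cong[OF A(1) M(1) B(1) t] left_tens[symmetric])
  have right_mult: "?F (s \<otimes>\<^bsub>?S\<^esub> t) = ?F s \<otimes>\<^bsub>?RC\<^esub> ?F t" if s: "s \<in> carrier ?TL" and t: "t \<in> carrier ?TL" for s t
  proof -
    \<comment> \<open>The product of \<open>?RC\<close> pulled back along \<open>?F\<close>. Being
      bilinear on the left-bracketed tensors, it can be expanded into triple sums just as the
      product of \<open>?S\<close> is.\<close>
    have bil: "bilinear_map K ?TL ?TL ?TR (\<lambda>s t. ?F s \<otimes>\<^bsub>?RC\<^esub> ?F t)"
      by (intro bilinear_mapI bilinear_map_comp_left[OF RC F] bilinear_map_comp_right[OF RC F] linear_mapD(1)[OF F])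
    have "?F (s \<otimes>\<^bsub>?S\<^esub> t) = tsum3 ?TR s (\<lambda>a m b. ?F (tsum3 ?TL t (\<lambda>a' m' b'. S a m b a' m' b')))"
      unfolding S_mult
      by (rule linear_map_tsum3[OF A(1) M(1) B(1) TL TR s F], rule tsum3_closed[OF A(1) M(1) B(1) TL t])
        (intro S; assumption)
    also have "\<dots> = tsum3 ?TR s (\<lambda>a m b. tsum3 ?TR t (\<lambda>a' m' b'.
        ?F (tens3 K A M B a m b) \<otimes>\<^bsub>?RC\<^esub> ?F (tens3 K A M B a' m' b')))"
    proof (rule tsum3_cong[OF A(1) M(1) B(1) s])
      fix a m b assume c: "a \<in> carrier A" "m \<in> carrier M" "b \<in> carrier B"
      have "?F (tsum3 ?TL t (\<lambda>a' m' b'. S a m b a' m' b')) = tsum3 ?TR t (\<lambda>a' m' b'. ?F (S a m b a' m' b'))"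
        by (rule linear_map_tsum3[OF A(1) M(1) B(1) TL TR t F]) (intro S c; assumption)
      also have "\<dots> = tsum3 ?TR t (\<lambda>a' m' b'. ?F (tens3 K A M B a m b) \<otimes>\<^bsub>?RC\<^esub> ?F (tens3 K A M B a' m' b'))"
        by (rule tsum3_cong[OF A(1) M(1) B(1) t]) (simp add: F_tens right_tens c)
      finally show "?F (tsum3 ?TL t (\<lambda>a' m' b'. S a m b a' m' b')) = \<dots>" .
    qed
    also have "\<dots> = ?F s \<otimes>\<^bsub>?RC\<^esub> ?F t"
      by (rule bilinear_map_tsum3_tens3[OF A(1) M(1) B(1) A(1) M(1) B(1) TR bil s t, symmetric])
    finally show ?thesis .
  qed
  \<comment> \<open>Each product differs from a plain iterated tensor product in \<open>mult\<close>
    alone. Carrier, unit and linear structure can thus be read off \<open>?TL\<close> and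
    \<open>?TR\<close>.\<close>
  have S_struct: "?S = ?TL\<lparr>mult := mult ?S\<rparr>"
    by (simp add: two_sided_crossed_product_def Let_def)
  have LC_struct: "?LC = ?TL\<lparr>mult := mult ?LC\<rparr>"
    by (simp add: left_crossed_product_def Let_def mult_update_simps)
  have RC_struct: "?RC = ?TR\<lparr>mult := mult ?RC\<rparr>"
    by (simp add: right_crossed_product_def Let_def mult_update_simps)
  \<comment> \<open>Separates the two halves of the claim: a linear bijection of plain tensor
    products that preserves the unit, and compatibility with the overwritten
    multiplications.\<close>
  have transfer: "f \<in> algebra_iso K ?S C"
    if C: "C = T\<lparr>mult := mult C\<rparr>" and f: "linear_map K ?TL T f" "bij_betw f (carrier ?TL) (carrier T)"
      "f \<one>\<^bsub>?TL\<^esub> = \<one>\<^bsub>T\<^esub>"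
      and mult: "\<And>s t. s \<in> carrier ?TL \<Longrightarrow> t \<in> carrier ?TL \<Longrightarrow> f (s \<otimes>\<^bsub>?S\<^esub> t) = f s \<otimes>\<^bsub>C\<^esub> f t" for f C T
  proof -
    have "carrier ?S = carrier ?TL" "carrier C = carrier T" "add ?S = add ?TL" "add C = add T"
      "smult ?S = smult ?TL" "smult C = smult T" "one ?S = one ?TL" "one C = one T"
      \<comment> \<open>\<open>S_struct\<close> and \<open>C\<close> repeat their left-hand side on
        the right and would loop as simp rules, hence the single steps of
        \<open>subst\<close>.\<close>
      by (subst S_struct, simp | subst C, simp)+
    then show ?thesis
      using f mult linear_mapD[OF f(1)] by (auto simp: algebra_iso_def algebra_hom_def ring_hom_def linear_map_def)
  qed
  have one: "\<one>\<^bsub>?TL\<^esub> = tens3 K A M B \<one>\<^bsub>A\<^esub> \<one>\<^bsub>M\<^esub> \<one>\<^bsub>B\<^esub>" "\<one>\<^bsub>?TR\<^esub> = tens K A ?MB \<one>\<^bsub>A\<^esub> (tens K M B \<one>\<^bsub>M\<^esub> \<one>\<^bsub>B\<^esub>)"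
    by (simp_all add: tensor_def tens_def)
  have one_closed: "\<one>\<^bsub>A\<^esub> \<in> carrier A" "\<one>\<^bsub>M\<^esub> \<in> carrier M" "\<one>\<^bsub>B\<^esub> \<in> carrier B"
    using ring.ring_simprules(6)[OF assoc_algebraD(3)[OF A_algebra]]
      ring.ring_simprules(6)[OF assoc_algebraD(3)[OF L.B_algebra]] M.M_algebra
    by (auto simp: unital_nonassoc_algebra_def)
  have "id \<in> algebra_iso K ?S ?LC"
    by (rule transfer[OF LC_struct]) (simp_all add: linear_map_def left_mult)
  moreover have "?F \<in> algebra_iso K ?S ?RC"
    by (rule transfer[OF RC_struct F assoc_right_bij[OF A(1) M(1) B(1)]])
      (simp_all add: one one_closed F_tens right_mult)
  ultimately show ?thesis by (simp add: quasi_smash_left_eq quasi_smash_right_eq)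
qed

end
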